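(* Let $J$ be an $SL(N,\mathbb{C})$-valued solution of the SDYM3 equation $F[J]\equiv D_{\bar y}(J^{-1}J_y)+D_z(J^{-1}J_z)=0$. Consider, for matrix-valued functions $Q$ and $Q'$, the system $$\hat A_y(J^{-1}Q)=D_z(J^{-1}Q'),\qquad \hat A_z(J^{-1}Q)=-D_{\bar y}(J^{-1}Q').$$ This system is an auto-Bäcklund transformation for the SDYM3 symmetry condition $S(Q;J)=0$: its integrability condition for $Q'$, obtained from $D_{\bar y}D_z(J^{-1}Q')=D_zD_{\bar y}(J^{-1}Q')$, is $S(Q;J)=0$; and its integrability condition for $Q$, obtained from $[\hat A_y,\hat A_z](J^{-1}Q)=0$, is $S(Q';J)=0$. Hence, whenever $Q$ and $Q'$ satisfy the system, both are symmetry characteristics of the SDYM3 equation (so the system acts as a recursion operator $Q\mapsto Q'$, with inverse $Q'\mapsto Q$).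
   Context: The independent variables are $y,z,\bar y$ (complex, treated as three independent variables). $D_y,D_z,D_{\bar y}$ are the total derivatives, also denoted by subscripts; they commute and satisfy the Leibniz rule. $[\cdot,\cdot]$ applied to matrices is the matrix commutator, and applied to operators it is the operator commutator. The covariant derivative operators act on matrix-valued functions $M$ by $$\hat A_yM=D_yM+[J^{-1}J_y,M],\qquad \hat A_zM=D_zM+[J^{-1}J_z,M].$$ A matrix-valued function $Q$ is a symmetry characteristic of SDYM3 if it satisfies the linear symmetry condition $$S(Q;J)\equiv (D_{\bar y}\hat A_y+D_z\hat A_z)(J^{-1}Q)=0$$ for solutions $J$ of $F[J]=0$. This is the linearization of $F[J]=0$ in the direction $\delta J=\alpha Q$. *)

theory Defs
  imports "HOL-Analysis.Analysis"
begin

(* Points are triples (y, z, yb) of independent complex variables, yb standing for ybar.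
   N is CARD('n). *)
type_synonym 'n matfun = "complex \<times> complex \<times> complex \<Rightarrow> complex^'n^'n"

(* Holomorphy in three variables: at every point each entry has a Frechet derivative
   that is complex-linear, written out with its three complex coefficients. *)
definition holomorphic3 ::
  "(complex \<times> complex \<times> complex) set \<Rightarrow> (complex \<times> complex \<times> complex \<Rightarrow> complex) \<Rightarrow> bool" where
  "holomorphic3 U f \<longleftrightarrow>
     (\<forall>x\<in>U. \<exists>a b c. (f has_derivative (\<lambda>(h, k, l). a * h + b * k + c * l)) (at x))"

definition mat_holomorphic ::
  "(complex \<times> complex \<times> complex) set \<Rightarrow> 'n::finite matfun \<Rightarrow> bool" where
  "mat_holomorphic U M \<longleftrightarrow> (\<forall>i j. holomorphic3 U (\<lambda>x. M x $ i $ j))"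

definition Dy :: "'n::finite matfun \<Rightarrow> 'n matfun" where
  "Dy M = (\<lambda>(y, z, yb). \<chi> i j. deriv (\<lambda>t. M (t, z, yb) $ i $ j) y)"

definition Dz :: "'n::finite matfun \<Rightarrow> 'n matfun" where
  "Dz M = (\<lambda>(y, z, yb). \<chi> i j. deriv (\<lambda>t. M (y, t, yb) $ i $ j) z)"

definition Dyb :: "'n::finite matfun \<Rightarrow> 'n matfun" where
  "Dyb M = (\<lambda>(y, z, yb). \<chi> i j. deriv (\<lambda>t. M (y, z, t) $ i $ j) yb)"

definition mat_comm :: "complex^'n^'n \<Rightarrow> complex^'n^'n \<Rightarrow> complex^'n::finite^'n" where
  "mat_comm A B = A ** B - B ** A"

definition op_comm ::
  "('n::finite matfun \<Rightarrow> 'n matfun) \<Rightarrow> ('n matfun \<Rightarrow> 'n matfun) \<Rightarrow> 'n matfun \<Rightarrow> 'n matfun" where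
  "op_comm A B M = (\<lambda>x. A (B M) x - B (A M) x)"

(* The pointwise product J^{-1} M. *)
definition inv_mult :: "'n::finite matfun \<Rightarrow> 'n matfun \<Rightarrow> 'n matfun" where
  "inv_mult J M = (\<lambda>x. matrix_inv (J x) ** M x)"

definition Ay :: "'n::finite matfun \<Rightarrow> 'n matfun \<Rightarrow> 'n matfun" where
  "Ay J M = (\<lambda>x. Dy M x + mat_comm (inv_mult J (Dy J) x) (M x))"

definition Az :: "'n::finite matfun \<Rightarrow> 'n matfun \<Rightarrow> 'n matfun" where
  "Az J M = (\<lambda>x. Dz M x + mat_comm (inv_mult J (Dz J) x) (M x))"

definition SDYM3 :: "'n::finite matfun \<Rightarrow> 'n matfun" where
  "SDYM3 J = (\<lambda>x. Dyb (inv_mult J (Dy J)) x + Dz (inv_mult J (Dz J)) x)"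

definition SL_valued_solution ::
  "(complex \<times> complex \<times> complex) set \<Rightarrow> 'n::finite matfun \<Rightarrow> bool" where
  "SL_valued_solution U J \<longleftrightarrow>
     mat_holomorphic U J \<and> (\<forall>x\<in>U. det (J x) = 1) \<and> (\<forall>x\<in>U. SDYM3 J x = 0)"

definition sym_cond :: "'n::finite matfun \<Rightarrow> 'n matfun \<Rightarrow> 'n matfun" where
  "sym_cond Q J = (\<lambda>x. Dyb (Ay J (inv_mult J Q)) x + Dz (Az J (inv_mult J Q)) x)"

definition symmetry_characteristic ::
  "(complex \<times> complex \<times> complex) set \<Rightarrow> 'n::finite matfun \<Rightarrow> 'n matfun \<Rightarrow> bool" where
  "symmetry_characteristic U J Q \<longleftrightarrow> mat_holomorphic U Q \<and> (\<forall>x\<in>U. sym_cond Q J x = 0)"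

definition BT_system ::
  "(complex \<times> complex \<times> complex) set \<Rightarrow> 'n::finite matfun \<Rightarrow> 'n matfun \<Rightarrow> 'n matfun \<Rightarrow> bool" where
  "BT_system U J Q Q' \<longleftrightarrow>
     (\<forall>x\<in>U. Ay J (inv_mult J Q) x = Dz (inv_mult J Q') x \<and>
            Az J (inv_mult J Q) x = - Dyb (inv_mult J Q') x)"

(* The system, read as equations for Q' with Q given: the equation obtained from
   Dyb Dz (J^{-1}Q') = Dz Dyb (J^{-1}Q') by substituting the system on both sides,
   and solvability for Q' near every point. *)
definition cross_condition_for_Q' ::
  "(complex \<times> complex \<times> complex) set \<Rightarrow> 'n::finite matfun \<Rightarrow> 'n matfun \<Rightarrow> bool" where
  "cross_condition_for_Q' U J Q \<longleftrightarrow>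
     (\<forall>x\<in>U. Dyb (Ay J (inv_mult J Q)) x = Dz (\<lambda>u. - Az J (inv_mult J Q) u) x)"

definition locally_solvable_for_Q' ::
  "(complex \<times> complex \<times> complex) set \<Rightarrow> 'n::finite matfun \<Rightarrow> 'n matfun \<Rightarrow> bool" where
  "locally_solvable_for_Q' U J Q \<longleftrightarrow>
     (\<forall>p\<in>U. \<exists>V Q'. open V \<and> p \<in> V \<and> V \<subseteq> U \<and> mat_holomorphic V Q' \<and> BT_system V J Q Q')"

(* The same with Q and Q' exchanged, starting from
   Ay (Az (J^{-1}Q)) = Az (Ay (J^{-1}Q)), i.e. [Ay, Az] (J^{-1}Q) = 0. *)
definition cross_condition_for_Q ::
  "(complex \<times> complex \<times> complex) set \<Rightarrow> 'n::finite matfun \<Rightarrow> 'n matfun \<Rightarrow> bool" where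
  "cross_condition_for_Q U J Q' \<longleftrightarrow>
     (\<forall>x\<in>U. Ay J (\<lambda>u. - Dyb (inv_mult J Q') u) x = Az J (Dz (inv_mult J Q')) x)"

definition locally_solvable_for_Q ::
  "(complex \<times> complex \<times> complex) set \<Rightarrow> 'n::finite matfun \<Rightarrow> 'n matfun \<Rightarrow> bool" where
  "locally_solvable_for_Q U J Q' \<longleftrightarrow>
     (\<forall>p\<in>U. \<exists>V Q. open V \<and> p \<in> V \<and> V \<subseteq> U \<and> mat_holomorphic V Q \<and> BT_system V J Q Q')"

end

(*
  Put A = J^-1 D J for a derivation D.  The covariant derivative D + [A, .] is D conjugated by
  M |-> J M J^-1, so the covariant derivatives commute because the partial derivatives do.
  Moving D_ybar past the covariant y-derivative and D_z past the covariant z-derivative produces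
  the commutator with F[J] = 0, so the symmetry condition can be written with the two kinds of
  derivative in either order; these two forms are the two cross conditions.  After conjugation
  by J, solving the system for Q or for Q' means integrating a closed 1-form in two of the three
  variables, which the homotopy formula does holomorphically in the remaining one.
*)

theory Submission
  imports Defs "HOL-Complex_Analysis.Cauchy_Integral_Formula"
begin

section \<open>Directional derivatives of holomorphic functions\<close>

text \<open>\<open>holomorphic3\<close> gives only a complex-linear derivative at each point:
  neither its continuity nor any second derivative is assumed. Yet covariant derivatives are
  differentiated again, partial derivatives are interchanged, and the homotopy formula is
  differentiated under the integral sign. All this regularity comes from Cauchy's formula on complex
  lines, which writes a directional derivative of \<open>f\<close> as an integral of values of
  \<open>f\<close> over a circle. The base point enters there as a mere parameter, so the integral
  yields first continuity and then holomorphy of the derivative. Derivatives are taken in arbitrary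
  directions, not just along the coordinate axes: one statement then serves all three variables, and
  as a function of the direction the same object is the full derivative that the chain rule needs.
  Solvability is local because a closed form on an arbitrary open set need not be exact; near a
  point a polydisc is available, and it is stable under the homotopy.\<close>

type_synonym triple = "complex \<times> complex \<times> complex"

text \<open>The type \<open>triple\<close> is treated by the analysis library as a real normed
  space; this is its complex scaling, in terms of which complex linearity of a derivative is
  expressed.\<close>

definition cscale :: "complex \<Rightarrow> triple \<Rightarrow> triple" where
  "cscale c h = (c * fst h, c * fst (snd h), c * snd (snd h))"

lemma cscale_add_left: "cscale (a + b) h = cscale a h + cscale b h"
  and cscale_scaleR_left: "cscale (r *\<^sub>R a) h = r *\<^sub>R cscale a h"
  and cscale_zero [simp]: "cscale 0 h = 0"
  by (simp_all add: cscale_def algebra_simps zero_prod_def)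

lemma norm_cscale: "norm (cscale c h) = norm c * norm h"
  by (cases h)
     (simp add: cscale_def norm_Pair norm_mult power_mult_distrib distrib_left [symmetric] real_sqrt_mult)

lemma bounded_linear_cscale: "bounded_linear (\<lambda>c. cscale c h)"
  by (rule bounded_linear_intro[where K = "norm h"])
     (simp_all add: cscale_add_left cscale_scaleR_left norm_cscale)

lemmas continuous_on_cscale [continuous_intros] =
  bounded_linear.continuous_on[OF bounded_linear_cscale]

definition pd :: "triple \<Rightarrow> (triple \<Rightarrow> complex) \<Rightarrow> triple \<Rightarrow> complex" where
  "pd e f x = deriv (\<lambda>t. f (x + cscale t e)) 0"

definition clinear3 :: "(triple \<Rightarrow> complex) \<Rightarrow> bool" where
  "clinear3 D \<longleftrightarrow> (\<forall>h k. D (h + k) = D h + D k) \<and> (\<forall>c h. D (cscale c h) = c * D h)"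

lemma clinear3_explicit: "clinear3 (\<lambda>(h, k, l). a * h + b * k + c * l)"
  by (auto simp: clinear3_def cscale_def algebra_simps)

text \<open>Expanding along the three coordinate vectors recovers the coefficients, so the explicit
  form in \<open>holomorphic3\<close> can be traded for the abstract
  \<open>clinear3\<close>.\<close>

lemma clinear3_imp_explicit:
  assumes "clinear3 D"
  shows "D = (\<lambda>(h, k, l). D (1,0,0) * h + D (0,1,0) * k + D (0,0,1) * l)"
proof
  fix x :: triple
  obtain h k l where x: "x = (h, k, l)" by (cases x)
  have "D x = D (cscale h (1,0,0) + (cscale k (0,1,0) + cscale l (0,0,1)))"
    by (simp add: x cscale_def)
  also have "\<dots> = h * D (1,0,0) + (k * D (0,1,0) + l * D (0,0,1))"
    using assms unfolding clinear3_def by metis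
  finally show "D x = (case x of (h, k, l) \<Rightarrow> D (1,0,0) * h + D (0,1,0) * k + D (0,0,1) * l)"
    by (simp add: x algebra_simps)
qed

text \<open>Chain rule along the complex line through \<open>x\<close>. Complex linearity turns
  \<open>D (cscale t e)\<close> into \<open>t * D e\<close>, so the restriction to the line has a
  complex derivative in one variable.\<close>

lemma pd_has_derivative:
  assumes "(f has_derivative D) (at x)" "clinear3 D"
  shows "pd e f x = D e"
proof -
  have *: "((\<lambda>t. x + cscale t e) has_derivative (\<lambda>t. cscale t e)) (at 0)"
    using bounded_linear_imp_has_derivative[OF bounded_linear_cscale, of e "at 0"]
      has_derivative_add[OF has_derivative_const] by fastforce
  have "((\<lambda>t. f (x + cscale t e)) has_derivative (\<lambda>t. D (cscale t e))) (at 0)"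
    using has_derivative_compose[OF *, of f D] assms(1) by simp
  then have "((\<lambda>t. f (x + cscale t e)) has_field_derivative D e) (at 0)"
    using assms(2)
    by (simp add: clinear3_def has_field_derivative_def mult_commute_abs del: split_paired_All)
  then show ?thesis unfolding pd_def by (rule DERIV_imp_deriv)
qed

lemma holomorphic3_iff:
  "holomorphic3 U f \<longleftrightarrow> (\<forall>x\<in>U. \<exists>D. (f has_derivative D) (at x) \<and> clinear3 D)"
  unfolding holomorphic3_def using clinear3_explicit clinear3_imp_explicit by metis

text \<open>The derivative is determined by its values, which are the directional derivatives; hence
  the existentially quantified \<open>D\<close> can be named.\<close>

lemma holomorphic3_iff_pd:
  "holomorphic3 U f \<longleftrightarrow>
    (\<forall>x\<in>U. (f has_derivative (\<lambda>h. pd h f x)) (at x) \<and> clinear3 (\<lambda>h. pd h f x))"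
proof -
  have "(\<lambda>h. pd h f x) = D" if "(f has_derivative D) (at x)" "clinear3 D" for D x
    using pd_has_derivative[OF that] by blast
  then show ?thesis unfolding holomorphic3_iff by metis
qed

lemma holomorphic3_has_derivative:
  "holomorphic3 U f \<Longrightarrow> x \<in> U \<Longrightarrow> (f has_derivative (\<lambda>h. pd h f x)) (at x)"
  and holomorphic3_clinear3: "holomorphic3 U f \<Longrightarrow> x \<in> U \<Longrightarrow> clinear3 (\<lambda>h. pd h f x)"
  by (simp_all add: holomorphic3_iff_pd)

lemma pd_add_dir: "holomorphic3 U f \<Longrightarrow> x \<in> U \<Longrightarrow> pd (h + k) f x = pd h f x + pd k f x"
  and pd_cscale_dir: "holomorphic3 U f \<Longrightarrow> x \<in> U \<Longrightarrow> pd (cscale c h) f x = c * pd h f x"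
  using holomorphic3_clinear3 unfolding clinear3_def by blast+

lemma holomorphic3_subset: "holomorphic3 U f \<Longrightarrow> V \<subseteq> U \<Longrightarrow> holomorphic3 V f"
  by (auto simp: holomorphic3_def)

lemma holomorphic3_continuous_on: "holomorphic3 U f \<Longrightarrow> continuous_on U f"
  by (intro continuous_at_imp_continuous_on ballI)
     (rule has_derivative_continuous[OF holomorphic3_has_derivative])

lemma pd_cong:
  assumes "open U" "x \<in> U" "\<And>u. u \<in> U \<Longrightarrow> f u = g u"
  shows "pd e f x = pd e g x"
  unfolding pd_def
proof (rule deriv_cong_ev)
  have "open ((\<lambda>t. x + cscale t e) -` U)"
    using assms(1) by (rule open_vimage) (intro continuous_intros)
  then have "\<forall>\<^sub>F t in nhds 0. x + cscale t e \<in> U"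
    using eventually_nhds_in_open[of "(\<lambda>t. x + cscale t e) -` U" 0] assms(2) by simp
  then show "\<forall>\<^sub>F t in nhds 0. f (x + cscale t e) = g (x + cscale t e)"
    by eventually_elim (rule assms(3))
qed simp

lemma holomorphic3_cong:
  assumes "open U" "\<And>u. u \<in> U \<Longrightarrow> f u = g u" "holomorphic3 U f"
  shows "holomorphic3 U g"
  unfolding holomorphic3_iff
proof
  fix x assume "x \<in> U"
  with assms(3) obtain D where D: "(f has_derivative D) (at x)" "clinear3 D"
    unfolding holomorphic3_iff by blast
  from has_derivative_transform_within_open[OF D(1) assms(1) \<open>x \<in> U\<close> assms(2)] D(2)
  show "\<exists>D. (g has_derivative D) (at x) \<and> clinear3 D" by blast
qed

lemma holomorphic3_const: "holomorphic3 U (\<lambda>x. c)"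
  unfolding holomorphic3_iff
  by (auto intro!: exI[of _ "\<lambda>x. 0"] simp: clinear3_def)

lemma
  assumes "holomorphic3 U f" "holomorphic3 U g"
  shows holomorphic3_add: "holomorphic3 U (\<lambda>x. f x + g x)"
    and pd_add: "x \<in> U \<Longrightarrow> pd e (\<lambda>x. f x + g x) x = pd e f x + pd e g x"
    and holomorphic3_mult: "holomorphic3 U (\<lambda>x. f x * g x)"
    and pd_mult: "x \<in> U \<Longrightarrow> pd e (\<lambda>x. f x * g x) x = f x * pd e g x + pd e f x * g x"
proof -
  have A: "((\<lambda>x. f x + g x) has_derivative (\<lambda>h. pd h f x + pd h g x)) (at x)"
       "clinear3 (\<lambda>h. pd h f x + pd h g x)" if "x \<in> U" for x
    using holomorphic3_has_derivative[OF assms(1) that] holomorphic3_has_derivative[OF assms(2) that]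
      holomorphic3_clinear3[OF assms(1) that] holomorphic3_clinear3[OF assms(2) that]
    by (auto intro!: derivative_eq_intros simp: clinear3_def algebra_simps simp del: split_paired_All)
  have M: "((\<lambda>x. f x * g x) has_derivative (\<lambda>h. f x * pd h g x + pd h f x * g x)) (at x)"
       "clinear3 (\<lambda>h. f x * pd h g x + pd h f x * g x)" if "x \<in> U" for x
    using holomorphic3_has_derivative[OF assms(1) that] holomorphic3_has_derivative[OF assms(2) that]
      holomorphic3_clinear3[OF assms(1) that] holomorphic3_clinear3[OF assms(2) that]
    by (auto intro!: derivative_eq_intros simp: clinear3_def algebra_simps simp del: split_paired_All)
  show "holomorphic3 U (\<lambda>x. f x + g x)" "holomorphic3 U (\<lambda>x. f x * g x)"
    unfolding holomorphic3_iff using A M by blast+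
  show "x \<in> U \<Longrightarrow> pd e (\<lambda>x. f x + g x) x = pd e f x + pd e g x"
    "x \<in> U \<Longrightarrow> pd e (\<lambda>x. f x * g x) x = f x * pd e g x + pd e f x * g x"
    using pd_has_derivative[OF A] pd_has_derivative[OF M] by auto
qed

lemma pd_const [simp]: "pd e (\<lambda>x. c) x = 0"
  by (simp add: pd_def)

lemma pd_cmult: "holomorphic3 U f \<Longrightarrow> x \<in> U \<Longrightarrow> pd e (\<lambda>x. c * f x) x = c * pd e f x"
  using pd_mult[OF holomorphic3_const, of U f x e c] by simp

lemma holomorphic3_sum:
  "(\<And>i. i \<in> I \<Longrightarrow> holomorphic3 U (f i)) \<Longrightarrow> holomorphic3 U (\<lambda>x. \<Sum>i\<in>I. f i x)"
  by (induction I rule: infinite_finite_induct) (auto intro: holomorphic3_const holomorphic3_add)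

lemma holomorphic3_prod:
  "(\<And>i. i \<in> I \<Longrightarrow> holomorphic3 U (f i)) \<Longrightarrow> holomorphic3 U (\<lambda>x. \<Prod>i\<in>I. f i x)"
  by (induction I rule: infinite_finite_induct) (auto intro: holomorphic3_const holomorphic3_mult)

lemma pd_sum:
  "(\<And>i. i \<in> I \<Longrightarrow> holomorphic3 U (f i)) \<Longrightarrow> x \<in> U \<Longrightarrow>
    pd e (\<lambda>x. \<Sum>i\<in>I. f i x) x = (\<Sum>i\<in>I. pd e (f i) x)"
proof (induction I rule: infinite_finite_induct)
  case (insert i I)
  then have "pd e (\<lambda>x. f i x + (\<Sum>i\<in>I. f i x)) x = pd e (f i) x + pd e (\<lambda>x. \<Sum>i\<in>I. f i x) x"
    by (intro pd_add[of U] holomorphic3_sum) auto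
  with insert show ?case by simp
qed auto

text \<open>Meant for affine inner maps (translations and contractions), hence the same
  \<open>L\<close> at every point. Commuting with \<open>cscale\<close> is what keeps the composite
  derivative complex-linear.\<close>

lemma holomorphic3_compose:
  assumes "holomorphic3 U f" "\<And>x. x \<in> V \<Longrightarrow> (\<phi> has_derivative L) (at x)"
    and "\<And>c h. L (cscale c h) = cscale c (L h)" "\<And>x. x \<in> V \<Longrightarrow> \<phi> x \<in> U"
  shows "holomorphic3 V (\<lambda>x. f (\<phi> x))"
    and "x \<in> V \<Longrightarrow> pd e (\<lambda>x. f (\<phi> x)) x = pd (L e) f (\<phi> x)"
proof -
  have D: "((\<lambda>x. f (\<phi> x)) has_derivative (\<lambda>h. pd (L h) f (\<phi> x))) (at x)"
    and L: "clinear3 (\<lambda>h. pd (L h) f (\<phi> x))" if "x \<in> V" for x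
  proof -
    show "((\<lambda>x. f (\<phi> x)) has_derivative (\<lambda>h. pd (L h) f (\<phi> x))) (at x)"
      by (rule has_derivative_compose[OF assms(2)[OF that]
            holomorphic3_has_derivative[OF assms(1) assms(4)[OF that]]])
    have "L (h + k) = L h + L k" for h k
      using has_derivative_bounded_linear[OF assms(2)[OF that]]
      by (simp add: linear_simps)
    then show "clinear3 (\<lambda>h. pd (L h) f (\<phi> x))"
      unfolding clinear3_def
      by (simp add: assms(3) pd_add_dir[OF assms(1) assms(4)[OF that]]
          pd_cscale_dir[OF assms(1) assms(4)[OF that]] del: split_paired_All)
  qed
  show "holomorphic3 V (\<lambda>x. f (\<phi> x))"
    unfolding holomorphic3_iff using D L by blast
  show "x \<in> V \<Longrightarrow> pd e (\<lambda>x. f (\<phi> x)) x = pd (L e) f (\<phi> x)"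
    using pd_has_derivative[OF D L] by blast
qed

lemma holomorphic3_translate:
  assumes "holomorphic3 U f" "\<And>x. x \<in> V \<Longrightarrow> x + a \<in> U"
  shows "holomorphic3 V (\<lambda>x. f (x + a))"
    and "pd e (\<lambda>x. f (x + a)) x = pd e f (x + a)"
proof -
  have "((\<lambda>x. x + a) has_derivative (\<lambda>h. h)) (at x)" for x
    by (rule derivative_eq_intros refl)+ simp
  then show "holomorphic3 V (\<lambda>x. f (x + a))"
    using assms by (intro holomorphic3_compose(1)[of U f V _ "\<lambda>h. h"]) simp_all
  show "pd e (\<lambda>x. f (x + a)) x = pd e f (x + a)"
    by (simp add: pd_def add_ac)
qed

section \<open>Integrals depending holomorphically on parameters\<close>

lemma holomorphic3_integral:
  fixes F :: "triple \<Rightarrow> real \<Rightarrow> complex"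
  assumes "open V" "convex V"
    and hol: "\<And>t. t \<in> {0..1} \<Longrightarrow> holomorphic3 V (\<lambda>x. F x t)"
    and cont: "continuous_on (V \<times> {0..1}) (\<lambda>(x, t). F x t)"
    and cont': "\<And>e. continuous_on (V \<times> {0..1}) (\<lambda>(x, t). pd e (\<lambda>x. F x t) x)"
  shows "holomorphic3 V (\<lambda>x. integral {0..1} (F x))"
    and "x \<in> V \<Longrightarrow> pd e (\<lambda>x. integral {0..1} (F x)) x = integral {0..1} (\<lambda>t. pd e (\<lambda>x. F x t) x)"
proof -
  \<comment> \<open>The Leibniz rule expects the derivative as a continuous family of bounded linear
    operators. Since \<open>triple\<close> is finite-dimensional, continuity in operator norm
    reduces to continuity for each fixed direction, which is \<open>cont'\<close>.\<close>
  define fx where "fx x t = Blinfun (\<lambda>h. pd h (\<lambda>x. F x t) x)" for x and t :: real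
  have fx: "blinfun_apply (fx x t) = (\<lambda>h. pd h (\<lambda>x. F x t) x)" if "x \<in> V" "t \<in> {0..1}" for x t
    unfolding fx_def
    using holomorphic3_has_derivative[OF hol[OF that(2)] that(1)]
    by (intro bounded_linear_Blinfun_apply has_derivative_bounded_linear)
  have cfx: "continuous_on (V \<times> {0..1}) (\<lambda>(x, t). fx x t)"
  proof (rule continuous_on_blinfun_componentwise)
    fix i :: triple
    have "continuous_on (V \<times> {0..1}) (\<lambda>p. (case p of (x, t) \<Rightarrow> fx x t) i) \<longleftrightarrow>
       continuous_on (V \<times> {0..1}) (\<lambda>(x, t). pd i (\<lambda>x. F x t) x)"
      by (rule continuous_on_cong) (auto simp: fx)
    then show "continuous_on (V \<times> {0..1}) (\<lambda>p. (case p of (x, t) \<Rightarrow> fx x t) i)"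
      using cont' by blast
  qed
  have D: "((\<lambda>x. integral {0..1} (F x)) has_derivative (\<lambda>h. integral {0..1} (\<lambda>t. pd h (\<lambda>x. F x t) x))) (at x)"
    and L: "clinear3 (\<lambda>h. integral {0..1} (\<lambda>t. pd h (\<lambda>x. F x t) x))" if x: "x \<in> V" for x
  proof -
    have sub: "continuous_on {0..1} (\<lambda>t. G x t)"
      if "x \<in> V" "continuous_on (V \<times> {0..1}) (\<lambda>(x, t). G x t)"
      for G :: "triple \<Rightarrow> real \<Rightarrow> 'b::topological_space" and x
    proof -
      have "continuous_on {0..1} (\<lambda>t. (x, t))" by (intro continuous_intros)
      from continuous_on_compose2[OF that(2) this] that(1) show ?thesis by auto
    qed
    have 1: "((\<lambda>x. integral (cbox 0 1) (F x)) has_derivative integral (cbox 0 1) (fx x)) (at x within V)"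
    proof (rule leibniz_rule[where a = "0::real" and b = 1, OF _ _ _ x assms(2)], unfold cbox_interval)
      fix u t assume "u \<in> V" "t \<in> {0..1::real}"
      then show "((\<lambda>x. F x t) has_derivative blinfun_apply (fx u t)) (at u within V)"
        using holomorphic3_has_derivative[OF hol] by (simp add: fx has_derivative_at_withinI)
    next
      fix u assume "u \<in> V"
      then show "F u integrable_on {0..1}"
        by (rule integrable_continuous_interval[OF sub[OF _ cont]])
    qed (rule cfx)
    have int: "fx x integrable_on {0..1}"
      using sub[OF x cfx] by (rule integrable_continuous_interval)
    have 2: "blinfun_apply (integral {0..1} (fx x)) = (\<lambda>h. integral {0..1} (\<lambda>t. pd h (\<lambda>x. F x t) x))"
    proof
      fix h
      have "blinfun_apply (integral {0..1} (fx x)) h = integral {0..1} ((\<lambda>b. blinfun_apply b h) \<circ> fx x)"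
        by (rule integral_linear[OF int blinfun.bounded_linear_left, symmetric])
      also have "\<dots> = integral {0..1} (\<lambda>t. pd h (\<lambda>x. F x t) x)"
        by (rule integral_cong) (simp add: fx x)
      finally show "blinfun_apply (integral {0..1} (fx x)) h = integral {0..1} (\<lambda>t. pd h (\<lambda>x. F x t) x)" .
    qed
    show "((\<lambda>x. integral {0..1} (F x)) has_derivative (\<lambda>h. integral {0..1} (\<lambda>t. pd h (\<lambda>x. F x t) x))) (at x)"
      using 1 unfolding cbox_interval 2 at_within_open[OF x assms(1)] .
    have i: "(\<lambda>t. pd h (\<lambda>x. F x t) x) integrable_on {0..1}" for h
      using sub[OF x cont'] by (rule integrable_continuous_interval)
    have "integral {0..1} (\<lambda>t. pd (h + k) (\<lambda>x. F x t) x) =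
        integral {0..1} (\<lambda>t. pd h (\<lambda>x. F x t) x + pd k (\<lambda>x. F x t) x)" for h k
      by (rule integral_cong) (simp add: pd_add_dir[OF hol x])
    moreover have "integral {0..1} (\<lambda>t. pd (cscale c h) (\<lambda>x. F x t) x) =
        integral {0..1} (\<lambda>t. c * pd h (\<lambda>x. F x t) x)" for c h
      by (rule integral_cong) (simp add: pd_cscale_dir[OF hol x])
    ultimately show "clinear3 (\<lambda>h. integral {0..1} (\<lambda>t. pd h (\<lambda>x. F x t) x))"
      by (simp add: clinear3_def integral_add[OF i i])
  qed
  show "holomorphic3 V (\<lambda>x. integral {0..1} (F x))"
    unfolding holomorphic3_iff using D L by blast
  show "x \<in> V \<Longrightarrow> pd e (\<lambda>x. integral {0..1} (F x)) x = integral {0..1} (\<lambda>t. pd e (\<lambda>x. F x t) x)"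
    using pd_has_derivative[OF D L] by blast
qed

section \<open>Cauchy's formula on complex lines and regularity of derivatives\<close>

lemma pd_Cauchy_integral:
  assumes hol: "holomorphic3 U f" and "r > 0"
    and U: "\<And>t. norm t \<le> r \<Longrightarrow> x + cscale t e \<in> U"
  shows "pd e f x = integral {0..1} (\<lambda>t. f (x + cscale (circlepath 0 r t) e) / circlepath 0 r t)"
proof -
  let ?g = "\<lambda>t. f (x + cscale t e)"
  have der: "(?g has_field_derivative pd e f (x + cscale t e)) (at t)" if "norm t \<le> r" for t
  proof -
    have *: "((\<lambda>t. x + cscale t e) has_derivative (\<lambda>t. cscale t e)) (at t)"
      using bounded_linear_imp_has_derivative[OF bounded_linear_cscale, of e "at t"]
        has_derivative_add[OF has_derivative_const] by fastforce
    show ?thesis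
      using has_derivative_compose[OF * holomorphic3_has_derivative[OF hol U[OF that]]]
      by (simp add: has_field_derivative_def pd_cscale_dir[OF hol U[OF that]]
          mult_commute_abs)
  qed
  have "continuous_on (cball 0 r) ?g"
    using der by (auto intro!: continuous_at_imp_continuous_on DERIV_isCont)
  moreover have "?g holomorphic_on ball 0 r"
    unfolding holomorphic_on_open[OF open_ball] using der by force
  ultimately have "((\<lambda>u. ?g u / u ^ Suc 1) has_contour_integral
      2 * pi * \<i> / fact 1 * (deriv ^^ 1) ?g 0) (circlepath 0 r)"
    using Cauchy_has_contour_integral_higher_derivative_circlepath[of 0 r ?g 0 1] \<open>r > 0\<close> by simp
  then have "((\<lambda>t. ?g (circlepath 0 r t) / (circlepath 0 r t)\<^sup>2 *
      vector_derivative (circlepath 0 r) (at t)) has_integral 2 * pi * \<i> * pd e f x) {0..1}"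
    by (simp add: has_contour_integral pd_def power2_eq_square)
  then have "((\<lambda>t. inverse (2 * pi * \<i>) * (?g (circlepath 0 r t) / (circlepath 0 r t)\<^sup>2 *
      vector_derivative (circlepath 0 r) (at t))) has_integral
      inverse (2 * pi * \<i>) * (2 * pi * \<i> * pd e f x)) {0..1}"
    by (rule has_integral_mult_right)
  \<comment> \<open>On the circle \<open>u = circlepath 0 r t\<close> one has du = 2 pi i u dt,
    which cancels the constant and one of the two factors \<open>u\<close> in the
    denominator.\<close>
  moreover have "inverse (2 * pi * \<i>) * (?g (circlepath 0 r t) / (circlepath 0 r t)\<^sup>2 *
      vector_derivative (circlepath 0 r) (at t)) = ?g (circlepath 0 r t) / circlepath 0 r t" for t
    using \<open>r > 0\<close>
    unfolding vector_derivative_circlepath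
    by (simp add: circlepath power2_eq_square field_simps)
  ultimately have "((\<lambda>t. ?g (circlepath 0 r t) / circlepath 0 r t) has_integral
      inverse (2 * pi * \<i>) * (2 * pi * \<i> * pd e f x)) {0..1}"
    by simp
  moreover have "inverse (2 * pi * \<i>) * (2 * pi * \<i> * pd e f x) = pd e f x"
    by (subst mult.assoc [symmetric], subst left_inverse) simp_all
  ultimately show ?thesis by (simp only: integral_unique)
qed

lemma circle_neighbourhood:
  assumes "open U" "x0 \<in> U"
  obtains r d where "r > 0" "d > 0"
    "\<And>x t. x \<in> ball x0 d \<Longrightarrow> norm t \<le> r \<Longrightarrow> x + cscale t e \<in> U"
proof -
  obtain \<rho> where \<rho>: "\<rho> > 0" "ball x0 \<rho> \<subseteq> U" using assms open_contains_ball by blast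
  \<comment> \<open>Half of \<open>\<rho>\<close> is spent on moving the base point, the other half
    on the shift by \<open>cscale t e\<close>. The added 1 keeps the quotient meaningful for
    \<open>e = 0\<close>.\<close>
  define r where "r = \<rho> / 2 / (norm e + 1)"
  have "norm e + 1 > 0" by (simp add: add_nonneg_pos)
  then have r: "r > 0" "r * norm e \<le> \<rho> / 2"
    using \<rho>(1) by (simp_all add: r_def field_simps)
  have "x + cscale t e \<in> U" if "x \<in> ball x0 (\<rho> / 2)" "norm t \<le> r" for x t
  proof -
    have "norm (cscale t e) \<le> \<rho> / 2"
      using r that(2) mult_right_mono[of "norm t" r "norm e"] by (auto simp: norm_cscale)
    then have "dist x0 (x + cscale t e) < \<rho>"
      using that(1) dist_triangle[of x0 "x + cscale t e" x] by (auto simp: dist_norm)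
    then show ?thesis using \<rho>(2) by auto
  qed
  with \<rho> r show thesis by (intro that[of r "\<rho> / 2"]) auto
qed

lemma circlepath_0_neq_0: "r > 0 \<Longrightarrow> circlepath 0 r t \<noteq> 0"
  and norm_circlepath_0: "r > 0 \<Longrightarrow> norm (circlepath 0 r t) = r"
  by (simp_all add: circlepath norm_mult)

lemma continuous_on_circlepath [continuous_intros]:
  "continuous_on A f \<Longrightarrow> continuous_on A (\<lambda>x. circlepath c r (f x))"
  unfolding circlepath by (intro continuous_intros)

lemma continuous_on_circle_translate:
  assumes "continuous_on U g" "r > 0"
    and "\<And>x t. x \<in> V \<Longrightarrow> norm t \<le> r \<Longrightarrow> x + cscale t e \<in> U"
  shows "continuous_on (V \<times> {0..1})
    (\<lambda>(x, t). g (x + cscale (circlepath 0 r t) e) / circlepath 0 r t)"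
  using assms
  by (auto simp: split_beta norm_circlepath_0 circlepath_0_neq_0
      intro!: continuous_intros continuous_on_compose2[OF assms(1)])

text \<open>Near \<open>x0\<close> one radius works for all base points, so there the derivative is
  a parameter integral with jointly continuous integrand.\<close>

lemma continuous_on_pd:
  assumes "open U" "holomorphic3 U f"
  shows "continuous_on U (pd e f)"
proof (rule continuous_at_imp_continuous_on, rule ballI)
  fix x0 assume "x0 \<in> U"
  obtain r d where rd: "r > 0" "d > 0"
    and U: "\<And>x t. x \<in> ball x0 d \<Longrightarrow> norm t \<le> r \<Longrightarrow> x + cscale t e \<in> U"
    using circle_neighbourhood[OF assms(1) \<open>x0 \<in> U\<close>] by metis
  have "continuous_on (ball x0 d)
      (\<lambda>x. integral (cbox 0 1) (\<lambda>t. f (x + cscale (circlepath 0 r t) e) / circlepath 0 r t))"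
    using continuous_on_circle_translate[OF holomorphic3_continuous_on[OF assms(2)] rd(1), of "ball x0 d", OF U]
    by (intro integral_continuous_on_param) (simp add: cbox_interval)
  then have "continuous_on (ball x0 d) (pd e f)"
    using pd_Cauchy_integral[OF assms(2) rd(1) U]
    by (subst continuous_on_cong[OF refl]) (auto simp: cbox_interval)
  then show "isCont (pd e f) x0"
    using rd(2) by (simp add: continuous_on_eq_continuous_at)
qed

text \<open>Differentiating the Cauchy formula for \<open>pd e f\<close> under the integral sign gives the Cauchy
  formula for \<open>pd e (pd h f)\<close>; this yields both claims.\<close>

lemma
  assumes "open U" "holomorphic3 U f"
  shows holomorphic3_pd: "holomorphic3 U (pd e f)"
    and pd_commute: "x \<in> U \<Longrightarrow> pd h (pd e f) x = pd e (pd h f) x"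
proof -
  \<comment> \<open>Symmetry is claimed only under holomorphy of \<open>pd h f\<close>, because
    Cauchy's formula is applied to that function as well. The first two conjuncts, being proved for
    every direction, discharge this condition afterwards.\<close>
  have "((pd e f) has_derivative (\<lambda>h. pd h (pd e f) x0)) (at x0) \<and> clinear3 (\<lambda>h. pd h (pd e f) x0)
      \<and> (\<forall>h. holomorphic3 U (pd h f) \<longrightarrow> pd h (pd e f) x0 = pd e (pd h f) x0)"
    if x0: "x0 \<in> U" for x0 e
  proof -
    obtain r d where rd: "r > 0" "d > 0"
      and U: "\<And>x t. x \<in> ball x0 d \<Longrightarrow> norm t \<le> r \<Longrightarrow> x + cscale t e \<in> U"
      using circle_neighbourhood[OF assms(1) x0] by metis
    let ?c = "circlepath 0 r" and ?V = "ball x0 d"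
    let ?F = "\<lambda>x t. inverse (?c t) * f (x + cscale (?c t) e)"
    have tr: "holomorphic3 ?V (\<lambda>x. f (x + cscale (?c t) e))" for t
      using U rd(1) norm_circlepath_0
      by (intro holomorphic3_translate(1)[OF assms(2)]) auto
    have hol: "holomorphic3 ?V (\<lambda>x. ?F x t)" for t
      by (intro holomorphic3_mult holomorphic3_const tr)
    have pdF: "pd h (\<lambda>x. ?F x t) x = pd h f (x + cscale (?c t) e) / ?c t" if "x \<in> ?V" for h x t
    proof -
      have "pd h (\<lambda>x. f (x + cscale (?c t) e)) x = pd h f (x + cscale (?c t) e)"
        using U rd(1) norm_circlepath_0 by (intro holomorphic3_translate(2)[OF assms(2), of ?V]) auto
      with pd_cmult[OF tr that, of h "inverse (?c t)" t] show ?thesis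
        by (simp only: divide_inverse mult.commute)
    qed
    have c1: "continuous_on (?V \<times> {0..1}) (\<lambda>(x, t). ?F x t)"
      using continuous_on_circle_translate[OF holomorphic3_continuous_on[OF assms(2)] rd(1), of ?V, OF U]
      by (simp add: field_simps)
    have c2: "continuous_on (?V \<times> {0..1}) (\<lambda>(x, t). pd h (\<lambda>x. ?F x t) x)" for h
    proof -
      have "continuous_on (?V \<times> {0..1}) (\<lambda>(x, t). pd h (\<lambda>x. ?F x t) x) \<longleftrightarrow>
        continuous_on (?V \<times> {0..1}) (\<lambda>(x, t). pd h f (x + cscale (?c t) e) / ?c t)"
        by (rule continuous_on_cong) (auto simp: pdF)
      then show ?thesis
        using continuous_on_circle_translate[OF continuous_on_pd[OF assms] rd(1), of ?V, OF U] by blast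
    qed
    have eq: "pd e f x = integral {0..1} (?F x)" if "x \<in> ?V" for x
      using pd_Cauchy_integral[OF assms(2) rd(1) U[OF that]] by (simp add: field_simps)
    note I = holomorphic3_integral[OF open_ball convex_ball hol c1 c2]
    have H: "holomorphic3 ?V (pd e f)"
      using holomorphic3_cong[OF open_ball _ I(1)] eq by simp
    have x0': "x0 \<in> ?V" using rd by simp
    have "pd h (pd e f) x0 = pd e (pd h f) x0" if "holomorphic3 U (pd h f)" for h
    proof -
      have "pd h (pd e f) x0 = pd h (\<lambda>x. integral {0..1} (?F x)) x0"
        by (rule pd_cong[OF open_ball x0']) (simp add: eq)
      also have "\<dots> = integral {0..1} (\<lambda>t. pd h f (x0 + cscale (?c t) e) / ?c t)"
        unfolding I(2)[OF x0'] by (simp add: pdF[OF x0'])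
      also have "\<dots> = pd e (pd h f) x0"
        using pd_Cauchy_integral[OF that rd(1) U[OF x0']] by simp
      finally show ?thesis .
    qed
    with H x0' show ?thesis
      by (simp add: holomorphic3_has_derivative holomorphic3_clinear3)
  qed
  note * = this
  show H: "holomorphic3 U (pd e f)" for e
    unfolding holomorphic3_iff using * by blast
  show "pd h (pd e f) x = pd e (pd h f) x" if "x \<in> U"
    using *[OF that] H by blast
qed

section \<open>The Poincare lemma\<close>

lemma clinear3_imp_bounded_linear:
  assumes "clinear3 D" shows "bounded_linear D"
proof -
  have "D (r *\<^sub>R h) = r *\<^sub>R D h" for r h
  proof -
    have "r *\<^sub>R h = cscale (of_real r) h"
      by (cases h) (simp add: cscale_def scaleR_conv_of_real)
    then show ?thesis using assms unfolding clinear3_def by (metis scaleR_conv_of_real)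
  qed
  then have "linear D" using assms unfolding clinear3_def by (intro linearI) blast+
  then show ?thesis by (simp add: linear_conv_bounded_linear)
qed

text \<open>When \<open>e\<close>, \<open>e'\<close> are dual to the linear forms
  \<open>\<pi>\<close>, \<open>\<pi>'\<close>, this multiplies both coordinates of
  \<open>x - c\<close> by \<open>t\<close> and leaves the remaining one alone: the identity at
  \<open>t = 1\<close>, a projection onto the slice through \<open>c\<close> at
  \<open>t = 0\<close>.\<close>

definition contraction ::
  "triple \<Rightarrow> triple \<Rightarrow> (triple \<Rightarrow> complex) \<Rightarrow> (triple \<Rightarrow> complex) \<Rightarrow> triple \<Rightarrow> real \<Rightarrow> triple \<Rightarrow> triple"
where
  "contraction e e' \<pi> \<pi>' c t x =
    x - cscale ((1 - t) * \<pi> (x - c)) e - cscale ((1 - t) * \<pi>' (x - c)) e'"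

text \<open>Here \<open>R\<close> is the homotopy operator of the Poincare lemma applied to the form
  \<open>f d\<pi> + g d\<pi>'\<close>, with the third variable as a parameter.\<close>

lemma homotopy_primitive:
  fixes f g \<pi> \<pi>' :: "triple \<Rightarrow> complex" and c e e' :: triple
  defines "R \<equiv> \<lambda>x. integral {0..1}
    (\<lambda>t. \<pi> (x - c) * f (contraction e e' \<pi> \<pi>' c t x) + \<pi>' (x - c) * g (contraction e e' \<pi> \<pi>' c t x))"
  assumes V: "open V" "convex V"
    and lin: "clinear3 \<pi>" "clinear3 \<pi>'" "\<pi> e = 1" "\<pi> e' = 0" "\<pi>' e = 0" "\<pi>' e' = 1"
    and mem: "\<And>t x. t \<in> {0..1} \<Longrightarrow> x \<in> V \<Longrightarrow> contraction e e' \<pi> \<pi>' c t x \<in> V"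
    and hol: "holomorphic3 V f" "holomorphic3 V g"
    and closed: "\<And>x. x \<in> V \<Longrightarrow> pd e' f x = pd e g x"
  shows "holomorphic3 V R" and "x \<in> V \<Longrightarrow> pd e R x = f x"
proof -
  let ?\<gamma> = "contraction e e' \<pi> \<pi>' c"
  define L where "L t h = h - cscale ((1 - of_real t) * \<pi> h) e - cscale ((1 - of_real t) * \<pi>' h) e'"
    for t :: real and h
  note bl = clinear3_imp_bounded_linear[OF lin(1)] clinear3_imp_bounded_linear[OF lin(2)]
  have \<gamma>': "(?\<gamma> t has_derivative L t) (at x)" for t x
    unfolding contraction_def L_def
    by (rule derivative_eq_intros refl bounded_linear.has_derivative[OF bounded_linear_cscale]
          bounded_linear.has_derivative[OF bl(1)] bounded_linear.has_derivative[OF bl(2)])+ simp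
  have \<pi>cs: "\<pi> (cscale a h) = a * \<pi> h" "\<pi>' (cscale a h) = a * \<pi>' h" for a h
    using lin(1,2) unfolding clinear3_def by blast+
  have cs: "cscale a (h - k) = cscale a h - cscale a k" "cscale a (cscale b h) = cscale (a * b) h"
    "cscale (a - b) h = cscale a h - cscale b h" "cscale 1 h = h" for a b h k
    by (simp_all add: cscale_def algebra_simps)
  have Lcs: "L t (cscale a h) = cscale a (L t h)" for t a h
    by (simp add: L_def cs \<pi>cs mult.left_commute)
  have Le: "L t e = cscale t e" for t
    by (simp add: L_def lin cs)
  have tr: "holomorphic3 V (\<lambda>x. k (?\<gamma> t x))"
      "x \<in> V \<Longrightarrow> pd h (\<lambda>x. k (?\<gamma> t x)) x = pd (L t h) k (?\<gamma> t x)"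
    if "holomorphic3 V k" "t \<in> {0..1}" for k h t x
    using holomorphic3_compose[of V k V "?\<gamma> t" "L t", OF that(1) \<gamma>' Lcs mem[OF that(2)]] by blast+
  \<comment> \<open>The direction \<open>L t h\<close> moves with \<open>t\<close>, while continuity
    of \<open>pd\<close> is known for fixed directions. Linearity in the direction expands it along
    \<open>h\<close>, \<open>e\<close> and \<open>e'\<close>.\<close>
  have pd_L: "pd (L t h) k y = pd h k y - (1 - t) * \<pi> h * pd e k y - (1 - t) * \<pi>' h * pd e' k y"
    if "holomorphic3 V k" "y \<in> V" for k h t y
  proof -
    have "L t h = h + (cscale (- ((1 - of_real t) * \<pi> h)) e + cscale (- ((1 - of_real t) * \<pi>' h)) e')"
      by (simp add: L_def cscale_def)
    then show ?thesis
      by (simp only: pd_add_dir[OF that] pd_cscale_dir[OF that]) simp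
  qed
  have pd_\<pi>: "holomorphic3 V (\<lambda>x. \<pi> (x - c))" "pd h (\<lambda>x. \<pi> (x - c)) x = \<pi> h"
    "holomorphic3 V (\<lambda>x. \<pi>' (x - c))" "pd h (\<lambda>x. \<pi>' (x - c)) x = \<pi>' h" for h x
  proof -
    have *: "((\<lambda>x. \<pi> (x - c)) has_derivative \<pi>) (at x)" "((\<lambda>x. \<pi>' (x - c)) has_derivative \<pi>') (at x)" for x
      by ((rule derivative_eq_intros refl bounded_linear.has_derivative[OF bl(1)]
          bounded_linear.has_derivative[OF bl(2)])+, simp)+
    show "holomorphic3 V (\<lambda>x. \<pi> (x - c))" "holomorphic3 V (\<lambda>x. \<pi>' (x - c))"
      unfolding holomorphic3_iff using * lin(1,2) by blast+
    show "pd h (\<lambda>x. \<pi> (x - c)) x = \<pi> h" "pd h (\<lambda>x. \<pi>' (x - c)) x = \<pi>' h"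
      using pd_has_derivative[OF *(1) lin(1)] pd_has_derivative[OF *(2) lin(2)] by auto
  qed
  let ?F = "\<lambda>x t. \<pi> (x - c) * f (?\<gamma> t x) + \<pi>' (x - c) * g (?\<gamma> t x)"
  have holF: "holomorphic3 V (\<lambda>x. ?F x t)" if "t \<in> {0..1}" for t
    by (intro holomorphic3_add holomorphic3_mult pd_\<pi> tr hol that)
  have pdF: "pd h (\<lambda>x. ?F x t) x =
      \<pi> (x - c) * pd (L t h) f (?\<gamma> t x) + \<pi> h * f (?\<gamma> t x) +
      (\<pi>' (x - c) * pd (L t h) g (?\<gamma> t x) + \<pi>' h * g (?\<gamma> t x))" if "t \<in> {0..1}" "x \<in> V" for h t x
    by (subst pd_add[OF _ _ that(2)] pd_mult[OF _ _ that(2)] tr(2)[OF _ that];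
        (intro holomorphic3_mult pd_\<pi> tr hol that)?)+ (simp add: pd_\<pi>)
  have c\<pi>: "continuous_on A (\<lambda>p. \<pi> (fst p - c))" "continuous_on A (\<lambda>p. \<pi>' (fst p - c))"
    for A :: "(triple \<times> real) set"
    by (intro bounded_linear.continuous_on[OF bl(1)] bounded_linear.continuous_on[OF bl(2)]
        continuous_intros)+
  have c\<gamma>: "continuous_on (V \<times> {0..1}) (\<lambda>p. ?\<gamma> (snd p) (fst p))"
    unfolding contraction_def by (intro continuous_intros c\<pi>)
  have ck: "continuous_on (V \<times> {0..1}) (\<lambda>p. k (?\<gamma> (snd p) (fst p)))" if "continuous_on V k"
    for k :: "triple \<Rightarrow> complex"
    by (rule continuous_on_compose2[OF that c\<gamma>]) (clarsimp simp: mem simp del: split_paired_All)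
  have c1: "continuous_on (V \<times> {0..1}) (\<lambda>(x, t). ?F x t)"
    unfolding split_beta
    by (intro continuous_intros c\<pi> ck holomorphic3_continuous_on hol)
  have c2: "continuous_on (V \<times> {0..1}) (\<lambda>(x, t). pd h (\<lambda>x. ?F x t) x)" for h
  proof -
    note hyp = ck[OF holomorphic3_continuous_on[OF hol(1)]] ck[OF holomorphic3_continuous_on[OF hol(2)]]
      ck[OF continuous_on_pd[OF V(1) hol(1)]] ck[OF continuous_on_pd[OF V(1) hol(2)]]
    have "continuous_on (V \<times> {0..1}) (\<lambda>(x, t). pd h (\<lambda>x. ?F x t) x) \<longleftrightarrow>
      continuous_on (V \<times> {0..1}) (\<lambda>(x, t).
      \<pi> (x - c) * (pd h f (?\<gamma> t x) - (1 - t) * \<pi> h * pd e f (?\<gamma> t x) - (1 - t) * \<pi>' h * pd e' f (?\<gamma> t x))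
      + \<pi> h * f (?\<gamma> t x) +
      (\<pi>' (x - c) * (pd h g (?\<gamma> t x) - (1 - t) * \<pi> h * pd e g (?\<gamma> t x) - (1 - t) * \<pi>' h * pd e' g (?\<gamma> t x))
      + \<pi>' h * g (?\<gamma> t x)))"
      by (rule continuous_on_cong[OF refl])
         (clarsimp simp: pdF pd_L[OF hol(1) mem] pd_L[OF hol(2) mem] simp del: split_paired_All)
    also have \<dots>
      unfolding split_beta
      by (intro continuous_on_add continuous_on_mult continuous_on_diff continuous_on_const
          continuous_on_of_real continuous_on_snd continuous_on_id c\<pi> hyp)
    finally show ?thesis .
  qed
  have I: "holomorphic3 V R" "x \<in> V \<Longrightarrow> pd e R x = integral {0..1} (\<lambda>t. pd e (\<lambda>x. ?F x t) x)" for x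
    unfolding R_def using holomorphic3_integral[of V ?F, OF V holF c1 c2] by blast+
  show "holomorphic3 V R" by (rule I(1))
  show "pd e R x = f x" if x: "x \<in> V"
  proof -
    \<comment> \<open>Because \<open>L t e\<close> is \<open>t\<close> times \<open>e\<close>,
      differentiating the integrand along \<open>e\<close> gives \<open>f\<close> plus
      \<open>t\<close> times a combination of \<open>pd e f\<close> and \<open>pd e g\<close>.
      Closedness replaces \<open>pd e g\<close> by \<open>pd e' f\<close>, and the sum becomes the
      \<open>t\<close>-derivative of \<open>t\<close> times \<open>f\<close> on the contracted
      point. The factor \<open>t\<close> kills the lower endpoint; the upper one is
      \<open>f x\<close>.\<close>
    have "((\<lambda>t. t *\<^sub>R f (?\<gamma> t x)) has_vector_derivative pd e (\<lambda>x. ?F x t) x) (at t within {0..1})"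
      if t: "t \<in> {0..1}" for t
    proof -
      let ?w = "cscale (\<pi> (x - c)) e + cscale (\<pi>' (x - c)) e'"
      have "((\<lambda>t. ?\<gamma> t x) has_derivative (\<lambda>s. cscale (s * \<pi> (x - c)) e + cscale (s * \<pi>' (x - c)) e'))
          (at t within {0..1})"
        unfolding contraction_def
        by (rule derivative_eq_intros refl bounded_linear.has_derivative[OF bounded_linear_cscale])+
           (simp add: cscale_def fun_eq_iff)
      then have "((\<lambda>t. f (?\<gamma> t x)) has_derivative
          (\<lambda>s. pd (cscale (s * \<pi> (x - c)) e + cscale (s * \<pi>' (x - c)) e') f (?\<gamma> t x))) (at t within {0..1})"
        by (rule has_derivative_compose[where g = f and g' = "\<lambda>h. pd h f (?\<gamma> t x)"])
           (rule holomorphic3_has_derivative[OF hol(1) mem[OF t x]])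
      then have "((\<lambda>t. f (?\<gamma> t x)) has_vector_derivative
          \<pi> (x - c) * pd e f (?\<gamma> t x) + \<pi>' (x - c) * pd e' f (?\<gamma> t x)) (at t within {0..1})"
        unfolding has_vector_derivative_def
        by (simp add: pd_add_dir[OF hol(1) mem[OF t x]] pd_cscale_dir[OF hol(1) mem[OF t x]]
            scaleR_conv_of_real algebra_simps)
      from has_vector_derivative_scaleR[OF DERIV_ident this]
      show ?thesis
        using closed[OF mem[OF t x]]
        by (simp add: pdF[OF t x] Le pd_cscale_dir[OF hol(1) mem[OF t x]]
            pd_cscale_dir[OF hol(2) mem[OF t x]] lin scaleR_conv_of_real algebra_simps)
    qed
    then have "((\<lambda>t. pd e (\<lambda>x. ?F x t) x) has_integral 1 *\<^sub>R f (?\<gamma> 1 x) - 0 *\<^sub>R f (?\<gamma> 0 x)) {0..1}"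
      by (intro fundamental_theorem_of_calculus) auto
    then show ?thesis
      unfolding I(2)[OF x] by (simp add: integral_unique contraction_def)
  qed
qed

text \<open>The primitive is symmetric under exchanging the two forms and directions, so the second
  equation is the first one with the roles swapped.\<close>

lemma Poincare_lemma_with_parameter:
  assumes V: "open V" "convex V"
    and lin: "clinear3 \<pi>" "clinear3 \<pi>'" "\<pi> e = 1" "\<pi> e' = 0" "\<pi>' e = 0" "\<pi>' e' = 1"
    and mem: "\<And>t x. t \<in> {0..1} \<Longrightarrow> x \<in> V \<Longrightarrow> contraction e e' \<pi> \<pi>' c t x \<in> V"
    and hol: "holomorphic3 V f" "holomorphic3 V g"
    and closed: "\<And>x. x \<in> V \<Longrightarrow> pd e' f x = pd e g x"
  shows "\<exists>R. holomorphic3 V R \<and> (\<forall>x\<in>V. pd e R x = f x \<and> pd e' R x = g x)"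
proof -
  have swap: "contraction e' e \<pi>' \<pi> c = contraction e e' \<pi> \<pi>' c"
    by (intro ext) (simp add: contraction_def)
  let ?R = "\<lambda>x. integral {0..1}
    (\<lambda>t. \<pi> (x - c) * f (contraction e e' \<pi> \<pi>' c t x) + \<pi>' (x - c) * g (contraction e e' \<pi> \<pi>' c t x))"
  have "pd e' ?R x = g x" if "x \<in> V" for x
    using homotopy_primitive(2)[of V \<pi>' \<pi> e' e c g f x, OF V lin(2,1,6,5,4,3) _ hol(2,1)] mem closed that
    by (simp add: swap add.commute)
  then show ?thesis
    using homotopy_primitive[OF V lin mem hol closed] by blast
qed

lemma polydisc_neighbourhood:
  fixes U :: "triple set"
  assumes "open U" "(a, b, c) \<in> U"
  obtains r s t where "(a, b, c) \<in> ball a r \<times> ball b s \<times> ball c t"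
    "ball a r \<times> ball b s \<times> ball c t \<subseteq> U"
proof -
  obtain A B where AB: "open A" "open B" "(a, b, c) \<in> A \<times> B" "A \<times> B \<subseteq> U"
    using open_prod_elim[OF assms] by metis
  then have "(b, c) \<in> B" by simp
  then obtain C D where CD: "open C" "open D" "(b, c) \<in> C \<times> D" "C \<times> D \<subseteq> B"
    using open_prod_elim[OF AB(2)] by metis
  obtain r s t where "r > 0" "ball a r \<subseteq> A" "s > 0" "ball b s \<subseteq> C" "t > 0" "ball c t \<subseteq> D"
    using AB CD by (metis SigmaD1 SigmaD2 openE)
  moreover from this have "ball a r \<times> ball b s \<times> ball c t \<subseteq> A \<times> B"
    using CD(4) by (intro Sigma_mono order_trans[OF Sigma_mono CD(4)])
  ultimately show thesis using AB(4) by (intro that[of r s t]) auto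
qed

text \<open>The neighbourhood is fixed before \<open>f\<close> and \<open>g\<close>, so that one
  choice serves all entries of a matrix. The pair (y, z) is used to solve for \<open>Q\<close>, the
  pair (z, ybar) to solve for \<open>Q'\<close>. In a polydisc, stability under
  \<open>contraction\<close> is checked in each disc separately.\<close>

lemma Poincare_neighbourhood:
  assumes "open U" "p \<in> U"
    and "(e, e') = ((1,0,0), (0,1,0)) \<or> (e, e') = ((0,1,0), (0,0,1))"
  obtains V where "open V" "p \<in> V" "V \<subseteq> U"
    "\<And>f g. \<lbrakk>holomorphic3 V f; holomorphic3 V g; \<And>x. x \<in> V \<Longrightarrow> pd e' f x = pd e g x\<rbrakk>
       \<Longrightarrow> \<exists>R. holomorphic3 V R \<and> (\<forall>x\<in>V. pd e R x = f x \<and> pd e' R x = g x)"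
proof -
  obtain a b c where p: "p = (a, b, c)" by (cases p)
  obtain r s t where V: "(a, b, c) \<in> ball a r \<times> ball b s \<times> ball c t"
    "ball a r \<times> ball b s \<times> ball c t \<subseteq> U"
    using polydisc_neighbourhood assms(1,2) unfolding p by metis
  define W where "W = ball a r \<times> ball b s \<times> ball c t"
  have W: "open W" "convex W" unfolding W_def
    by (intro open_Times open_ball convex_Times convex_ball)+
  \<comment> \<open>The point is the convex combination of the centre \<open>z\<close> with weight
    \<open>1 - u\<close> and of \<open>x\<close> with weight \<open>u\<close>.\<close>
  have seg: "x - (1 - of_real u) * (x - z) \<in> ball z d" if "x \<in> ball z d" "u \<in> {0..1}" "z \<in> ball z d"
    for x z :: complex and d u
  proof -
    have "(1 - u) *\<^sub>R z + u *\<^sub>R x \<in> ball z d"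
      using that by (intro convexD_alt convex_ball) auto
    then show ?thesis by (simp add: scaleR_conv_of_real algebra_simps)
  qed
  define \<pi> where "\<pi> = (if e = (1,0,0) then fst else fst \<circ> snd :: triple \<Rightarrow> complex)"
  define \<pi>' where "\<pi>' = (if e = (1,0,0) then fst \<circ> snd else snd \<circ> snd :: triple \<Rightarrow> complex)"
  have coord: "clinear3 fst" "clinear3 (fst \<circ> snd)" "clinear3 (snd \<circ> snd)"
    by (simp_all add: clinear3_def cscale_def)
  consider "e = (1,0,0)" "e' = (0,1,0)" "\<pi> = fst" "\<pi>' = fst \<circ> snd"
    | "e = (0,1,0)" "e' = (0,0,1)" "\<pi> = fst \<circ> snd" "\<pi>' = snd \<circ> snd"
    using assms(3) by (auto simp: \<pi>_def \<pi>'_def)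
  note cases = this
  have lin: "clinear3 \<pi>" "clinear3 \<pi>'" "\<pi> e = 1" "\<pi> e' = 0" "\<pi>' e = 0" "\<pi>' e' = 1"
    by (rule cases; simp add: coord)+
  have mem: "contraction e e' \<pi> \<pi>' p u x \<in> W" if "u \<in> {0..1}" "x \<in> W" for u x
  proof -
    obtain x1 x2 x3 where x: "x = (x1, x2, x3)" by (cases x)
    show ?thesis
      using that V(1) seg[of x1 a r u] seg[of x2 b s u] seg[of x3 c t u]
      by (rule_tac cases) (simp_all add: x p W_def contraction_def cscale_def del: mem_ball)
  qed
  show thesis
    using V W Poincare_lemma_with_parameter[OF W lin mem]
    by (intro that[of W]) (simp_all add: W_def p)
qed

section \<open>Matrix-valued functions and covariant derivatives\<close>

definition mpd :: "triple \<Rightarrow> 'n::finite matfun \<Rightarrow> 'n matfun" where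
  "mpd e M = (\<lambda>x. \<chi> i j. pd e (\<lambda>u. M u $ i $ j) x)"

lemma Dy_eq_mpd: "Dy = mpd (1,0,0)"
  and Dz_eq_mpd: "Dz = mpd (0,1,0)"
  and Dyb_eq_mpd: "Dyb = mpd (0,0,1)"
  unfolding Dy_def Dz_def Dyb_def mpd_def pd_def
  by (intro ext; clarsimp simp: vec_eq_iff cscale_def deriv_shift_0' o_def)+

lemma mpd_cong:
  assumes "open U" "x \<in> U" "\<And>u. u \<in> U \<Longrightarrow> M u = N u"
  shows "mpd e M x = mpd e N x"
proof -
  have "pd e (\<lambda>u. M u $ i $ j) x = pd e (\<lambda>u. N u $ i $ j) x" for i j
    by (rule pd_cong[OF assms(1,2)]) (simp add: assms(3))
  then show ?thesis by (simp add: mpd_def vec_eq_iff)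
qed

lemma mat_holomorphic_cong:
  assumes "open U" "\<And>u. u \<in> U \<Longrightarrow> M u = N u" "mat_holomorphic U M"
  shows "mat_holomorphic U N"
  unfolding mat_holomorphic_def
proof (intro allI)
  fix i j
  show "holomorphic3 U (\<lambda>x. N x $ i $ j)"
    by (rule holomorphic3_cong[OF assms(1), of "\<lambda>x. M x $ i $ j"])
       (use assms(2,3) in \<open>simp_all add: mat_holomorphic_def\<close>)
qed

lemma mat_holomorphic_subset: "mat_holomorphic U M \<Longrightarrow> V \<subseteq> U \<Longrightarrow> mat_holomorphic V M"
  unfolding mat_holomorphic_def using holomorphic3_subset by blast

lemma mat_holomorphic_mpd: "open U \<Longrightarrow> mat_holomorphic U M \<Longrightarrow> mat_holomorphic U (mpd e M)"
  by (simp add: mat_holomorphic_def mpd_def holomorphic3_pd)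

lemma mpd_commute:
  assumes "open U" "mat_holomorphic U M" "x \<in> U"
  shows "mpd e (mpd e' M) x = mpd e' (mpd e M) x"
  using assms by (simp add: mpd_def mat_holomorphic_def vec_eq_iff pd_commute[of U _ x e e'])

lemma
  assumes "mat_holomorphic U M" "mat_holomorphic U N"
  shows mat_holomorphic_add: "mat_holomorphic U (\<lambda>x. M x + N x)"
    and mat_holomorphic_diff: "mat_holomorphic U (\<lambda>x. M x - N x)"
    and mat_holomorphic_mult: "mat_holomorphic U (\<lambda>x. M x ** N x)"
    and mpd_add: "x \<in> U \<Longrightarrow> mpd e (\<lambda>x. M x + N x) x = mpd e M x + mpd e N x"
    and mpd_diff: "x \<in> U \<Longrightarrow> mpd e (\<lambda>x. M x - N x) x = mpd e M x - mpd e N x"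
    and mpd_mult: "x \<in> U \<Longrightarrow> mpd e (\<lambda>x. M x ** N x) x = mpd e M x ** N x + M x ** mpd e N x"
proof -
  have h: "holomorphic3 U (\<lambda>x. M x $ i $ j)" "holomorphic3 U (\<lambda>x. N x $ i $ j)" for i j
    using assms by (simp_all add: mat_holomorphic_def)
  have hm: "holomorphic3 U (\<lambda>x. -1 * N x $ i $ j)" for i j
    by (intro holomorphic3_mult holomorphic3_const h)
  have hp: "holomorphic3 U (\<lambda>x. M x $ i $ k * N x $ k $ j)" for i j k
    by (intro holomorphic3_mult h)
  show "mat_holomorphic U (\<lambda>x. M x + N x)"
    using holomorphic3_add[OF h] by (simp add: mat_holomorphic_def)
  show "mat_holomorphic U (\<lambda>x. M x - N x)"
    using holomorphic3_add[OF h(1) hm] by (simp add: mat_holomorphic_def)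
  show "mat_holomorphic U (\<lambda>x. M x ** N x)"
    unfolding mat_holomorphic_def matrix_matrix_mult_def vec_lambda_beta
    by (intro allI holomorphic3_sum hp)
  show "x \<in> U \<Longrightarrow> mpd e (\<lambda>x. M x + N x) x = mpd e M x + mpd e N x"
    using pd_add[OF h] by (simp add: mpd_def vec_eq_iff)
  show "x \<in> U \<Longrightarrow> mpd e (\<lambda>x. M x - N x) x = mpd e M x - mpd e N x"
    using pd_add[OF h(1) hm] pd_cmult[OF h(2), of _ _ "-1"] by (simp add: mpd_def vec_eq_iff)
  show "mpd e (\<lambda>x. M x ** N x) x = mpd e M x ** N x + M x ** mpd e N x" if "x \<in> U"
  proof -
    have "pd e (\<lambda>x. \<Sum>k\<in>UNIV. M x $ i $ k * N x $ k $ j) x =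
      (\<Sum>k\<in>UNIV. pd e (\<lambda>x. M x $ i $ k * N x $ k $ j) x)" for i j
      by (rule pd_sum[OF hp that])
    then show ?thesis
      by (simp add: mpd_def vec_eq_iff matrix_matrix_mult_def sum.distrib add.commute
          pd_mult[OF h that])
  qed
qed

lemma mat_holomorphic_const: "mat_holomorphic U (\<lambda>x. C)"
  by (simp add: mat_holomorphic_def holomorphic3_const)

lemma mpd_const: "mpd e (\<lambda>x. C) x = 0"
  by (simp add: mpd_def vec_eq_iff)

lemma mat_holomorphic_uminus: "mat_holomorphic U M \<Longrightarrow> mat_holomorphic U (\<lambda>x. - M x)"
  using mat_holomorphic_diff[OF mat_holomorphic_const, of U M 0] by simp

lemma mpd_uminus: "mat_holomorphic U M \<Longrightarrow> x \<in> U \<Longrightarrow> mpd e (\<lambda>x. - M x) x = - mpd e M x"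
  using mpd_diff[OF mat_holomorphic_const, of U M x e 0] by (simp add: mpd_const)

section \<open>Matrix algebra and holomorphy of the inverse\<close>

lemma matrix_mult_linear:
  fixes A B C :: "complex^'n::finite^'n"
  shows "(A - B) ** C = A ** C - B ** C" "C ** (A - B) = C ** A - C ** B"
    "(- A) ** C = - (A ** C)" "C ** (- A) = - (C ** A)"
    "(A + B) ** C = A ** C + B ** C" "C ** (A + B) = C ** A + C ** B"
  by (simp_all add: matrix_matrix_mult_def vec_eq_iff algebra_simps sum_subtractf sum_negf sum.distrib)

lemmas matrix_ring_simps = matrix_mult_linear matrix_mul_assoc

lemma matrix_inv_cancel:
  fixes A :: "complex^'n::finite^'n"
  assumes "det A = 1"
  shows "A ** matrix_inv A = mat 1" "matrix_inv A ** A = mat 1"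
proof -
  have "\<exists>B. A ** B = mat 1 \<and> B ** A = mat 1"
    using assms invertible_det_nz[of A] by (simp add: invertible_def)
  then have "A ** matrix_inv A = mat 1 \<and> matrix_inv A ** A = mat 1"
    unfolding matrix_inv_def by (rule someI_ex)
  then show "A ** matrix_inv A = mat 1" "matrix_inv A ** A = mat 1" by auto
qed

text \<open>Cramer's rule; the determinant in the denominator is 1.\<close>

lemma matrix_inv_entry:
  fixes A :: "complex^'n::finite^'n"
  assumes "det A = 1"
  shows "matrix_inv A $ k $ l = det (\<chi> i j. if j = k then mat 1 $ i $ l else A $ i $ j)"
proof -
  let ?v = "(\<chi> k. matrix_inv A $ k $ l) :: complex^'n" and ?b = "(\<chi> i. mat 1 $ i $ l) :: complex^'n"
  from matrix_inv_cancel(1)[OF assms] have "A *v ?v = ?b"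
    by (simp add: vec_eq_iff matrix_vector_mult_def matrix_matrix_mult_def)
  then have "?v = (\<chi> k. det (\<chi> i j. if j = k then ?b $ i else A $ i $ j) / det A)"
    using cramer[of A ?v ?b] assms by simp
  then show ?thesis using assms by (simp add: vec_eq_iff cong: if_cong)
qed

text \<open>With determinant 1 the entries of the inverse are polynomials in the entries of
  \<open>J\<close>, so closure of holomorphy under sums and products is enough.\<close>

lemma mat_holomorphic_inv:
  assumes "open U" "mat_holomorphic U J" "\<And>x. x \<in> U \<Longrightarrow> det (J x) = 1"
  shows "mat_holomorphic U (\<lambda>x. matrix_inv (J x))"
proof (rule mat_holomorphic_cong[OF assms(1)])
  fix u assume "u \<in> U"
  then show "(\<chi> k l. det (\<chi> i j. if j = k then mat 1 $ i $ l else J u $ i $ j)) = matrix_inv (J u)"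
    by (simp add: vec_eq_iff matrix_inv_entry assms(3))
next
  have h: "holomorphic3 U (\<lambda>x. if P then c else J x $ i $ j)" for P c i j
    using assms(2) by (cases P) (simp_all add: mat_holomorphic_def holomorphic3_const)
  show "mat_holomorphic U (\<lambda>x. \<chi> k l. det (\<chi> i j. if j = k then mat 1 $ i $ l else J x $ i $ j))"
    unfolding mat_holomorphic_def det_def
    by (simp only: vec_lambda_beta)
       (intro allI holomorphic3_sum holomorphic3_mult holomorphic3_const holomorphic3_prod h)
qed

section \<open>Covariant derivatives in the gauge given by \<open>J\<close>\<close>

definition cov :: "triple \<Rightarrow> 'n::finite matfun \<Rightarrow> 'n matfun \<Rightarrow> 'n matfun" where
  "cov e J M = (\<lambda>x. mpd e M x + mat_comm (inv_mult J (mpd e J) x) (M x))"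

lemma Ay_eq_cov: "Ay = cov (1,0,0)"
  and Az_eq_cov: "Az = cov (0,1,0)"
  by (intro ext, simp add: Ay_def Az_def cov_def Dy_eq_mpd Dz_eq_mpd)+

lemma cov_cong:
  assumes "open U" "x \<in> U" "\<And>u. u \<in> U \<Longrightarrow> M u = N u"
  shows "cov e J M x = cov e J N x"
  using assms(2,3) by (simp add: cov_def mpd_cong[OF assms])

lemma cov_uminus:
  "mat_holomorphic U M \<Longrightarrow> x \<in> U \<Longrightarrow> cov e J (\<lambda>x. - M x) x = - cov e J M x"
  by (simp add: cov_def mpd_uminus mat_comm_def matrix_ring_simps)

text \<open>The field equation is left to the individual lemmas, so that it is visible where it
  enters. The open set is a parameter because the local solutions live on a smaller
  \<open>V\<close>.\<close>

locale SL_function =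
  fixes U :: "triple set" and J :: "'n::finite matfun"
  assumes open_U: "open U"
    and hol_J: "mat_holomorphic U J"
    and det_J: "\<And>x. x \<in> U \<Longrightarrow> det (J x) = 1"
begin

abbreviation Ji :: "'n matfun" where "Ji \<equiv> \<lambda>x. matrix_inv (J x)"

lemma hol_Ji: "mat_holomorphic U Ji"
  by (rule mat_holomorphic_inv[OF open_U hol_J det_J])

lemma inv_cancel:
  assumes "x \<in> U"
  shows "J x ** Ji x = mat 1" "Ji x ** J x = mat 1" "A ** J x ** Ji x = A" "A ** Ji x ** J x = A"
proof -
  show *: "J x ** Ji x = mat 1" "Ji x ** J x = mat 1"
    by (rule matrix_inv_cancel[OF det_J[OF assms]])+
  show "A ** J x ** Ji x = A" "A ** Ji x ** J x = A"
    by (simp_all add: * flip: matrix_mul_assoc)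
qed

lemma hol_inv_mult: "mat_holomorphic U M \<Longrightarrow> mat_holomorphic U (inv_mult J M)"
  unfolding inv_mult_def by (rule mat_holomorphic_mult[OF hol_Ji])

lemma hol_cov:
  assumes "mat_holomorphic U M"
  shows "mat_holomorphic U (cov e J M)"
proof -
  have a: "mat_holomorphic U (inv_mult J (mpd e J))"
    by (rule hol_inv_mult[OF mat_holomorphic_mpd[OF open_U hol_J]])
  show ?thesis
    unfolding cov_def mat_comm_def
    by (rule mat_holomorphic_add[OF mat_holomorphic_mpd[OF open_U assms]
          mat_holomorphic_diff[OF mat_holomorphic_mult[OF a assms] mat_holomorphic_mult[OF assms a]]])
qed

lemma mpd_Ji:
  assumes "x \<in> U"
  shows "mpd e Ji x = - (Ji x ** mpd e J x ** Ji x)"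
proof -
  have "mpd e (\<lambda>x. Ji x ** J x) x = 0"
    using mpd_cong[OF open_U assms, of "\<lambda>x. Ji x ** J x" "\<lambda>x. mat 1"]
    by (simp add: mpd_const inv_cancel)
  then have "mpd e Ji x ** J x = - (Ji x ** mpd e J x)"
    by (simp add: mpd_mult[OF hol_Ji hol_J assms] eq_neg_iff_add_eq_0)
  then have "mpd e Ji x ** J x ** Ji x = - (Ji x ** mpd e J x) ** Ji x"
    by simp
  then show ?thesis
    by (simp add: inv_cancel[OF assms] matrix_ring_simps)
qed

text \<open>The connection is pure gauge: \<open>cov e J\<close> is \<open>mpd e\<close> conjugated by \<open>M \<mapsto> J M J\<^sup>-\<^sup>1\<close>.\<close>

lemma conj_cov:
  assumes "mat_holomorphic U M" "x \<in> U"
  shows "J x ** cov e J M x ** Ji x = mpd e (\<lambda>u. J u ** M u ** Ji u) x"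
proof -
  have "mpd e (\<lambda>u. J u ** M u ** Ji u) x =
    (mpd e J x ** M x + J x ** mpd e M x) ** Ji x + J x ** M x ** mpd e Ji x"
    by (simp only: mpd_mult[OF mat_holomorphic_mult[OF hol_J assms(1)] hol_Ji assms(2)]
        mpd_mult[OF hol_J assms(1,2)])
  then show ?thesis
    by (simp only: mpd_Ji[OF assms(2)] cov_def mat_comm_def inv_mult_def matrix_ring_simps
        inv_cancel[OF assms(2)] matrix_mul_lid) simp
qed

lemma cov_eq_conj:
  assumes "mat_holomorphic U M" "x \<in> U"
  shows "cov e J M x = Ji x ** mpd e (\<lambda>u. J u ** M u ** Ji u) x ** J x"
  by (simp only: conj_cov[OF assms, symmetric] matrix_mul_assoc inv_cancel[OF assms(2)] matrix_mul_lid)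

lemma cov_commute:
  assumes "mat_holomorphic U M" "x \<in> U"
  shows "cov e J (cov e' J M) x = cov e' J (cov e J M) x"
proof -
  \<comment> \<open>The inner conjugation by \<open>J\<close> cancels against the outer one, which
    leaves the conjugate of an iterated partial derivative.\<close>
  have "cov e J (cov e' J M) x = Ji x ** mpd e (mpd e' (\<lambda>u. J u ** M u ** Ji u)) x ** J x" for e e'
    by (simp only: cov_eq_conj[OF hol_cov[OF assms(1)] assms(2)]
        mpd_cong[OF open_U assms(2) conj_cov[OF assms(1)]])
  moreover have "mat_holomorphic U (\<lambda>u. J u ** M u ** Ji u)"
    by (intro mat_holomorphic_mult hol_J hol_Ji assms)
  ultimately show ?thesis
    by (simp only: mpd_commute[OF open_U _ assms(2), of _ e e'])
qed

text \<open>The partial derivatives commute, so by the Leibniz rule only the derivative of the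
  potential survives in the commutator of \<open>mpd e\<close> with \<open>cov e' J\<close>.\<close>

lemma mpd_cov:
  assumes "mat_holomorphic U M" "x \<in> U"
  shows "mpd e (cov e' J M) x =
    cov e' J (mpd e M) x + mat_comm (mpd e (inv_mult J (mpd e' J)) x) (M x)"
proof -
  let ?a = "inv_mult J (mpd e' J)"
  have a: "mat_holomorphic U ?a"
    by (rule hol_inv_mult[OF mat_holomorphic_mpd[OF open_U hol_J]])
  note aM = mat_holomorphic_mult[OF a assms(1)] mat_holomorphic_mult[OF assms(1) a]
  have "mpd e (cov e' J M) x = mpd e (mpd e' M) x +
     (mpd e ?a x ** M x + ?a x ** mpd e M x - (mpd e M x ** ?a x + M x ** mpd e ?a x))"
    unfolding cov_def mat_comm_def
    by (simp only: mpd_add[OF mat_holomorphic_mpd[OF open_U assms(1)] mat_holomorphic_diff[OF aM] assms(2)]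
        mpd_diff[OF aM assms(2)] mpd_mult[OF a assms] mpd_mult[OF assms(1) a assms(2)])
  also have "mpd e (mpd e' M) x = mpd e' (mpd e M) x"
    by (rule mpd_commute[OF open_U assms])
  finally show ?thesis
    unfolding cov_def mat_comm_def by (simp only: algebra_simps)
qed

section \<open>The symmetry condition and the two cross conditions\<close>

lemma sym_cond_eq:
  assumes "mat_holomorphic U Q" "x \<in> U" "SDYM3 J x = 0"
  shows "sym_cond Q J x = Ay J (Dyb (inv_mult J Q)) x + Az J (Dz (inv_mult J Q)) x"
proof -
  let ?P = "inv_mult J Q"
  \<comment> \<open>The two corrections from \<open>mpd_cov\<close> contain the ybar-derivative of
    the y-potential and the z-derivative of the z-potential, whose sum is
    \<open>SDYM3 J\<close>.\<close>
  have "sym_cond Q J x = Ay J (Dyb ?P) x + Az J (Dz ?P) x + mat_comm (SDYM3 J x) (?P x)"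
    unfolding sym_cond_def SDYM3_def Ay_eq_cov Az_eq_cov Dy_eq_mpd Dz_eq_mpd Dyb_eq_mpd
    by (simp add: mpd_cov[OF hol_inv_mult[OF assms(1)] assms(2)] mat_comm_def matrix_ring_simps)
  then show ?thesis by (simp add: assms(3) mat_comm_def matrix_matrix_mult_def vec_eq_iff)
qed

lemma cross_condition_for_Q'_iff:
  assumes "mat_holomorphic U Q"
  shows "cross_condition_for_Q' U J Q \<longleftrightarrow> (\<forall>x\<in>U. sym_cond Q J x = 0)"
  by (simp add: cross_condition_for_Q'_def sym_cond_def Ay_eq_cov Az_eq_cov Dz_eq_mpd
      mpd_uminus[OF hol_cov[OF hol_inv_mult[OF assms]]] eq_neg_iff_add_eq_0)

text \<open>Here the partial derivatives stand inside the covariant ones, opposite to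
  \<open>sym_cond\<close>. Exchanging the order uses the field equation, in contrast to the
  condition for \<open>Q'\<close>, where only a sign is moved.\<close>

lemma cross_condition_for_Q_iff:
  assumes "mat_holomorphic U Q'" "\<And>x. x \<in> U \<Longrightarrow> SDYM3 J x = 0"
  shows "cross_condition_for_Q U J Q' \<longleftrightarrow> (\<forall>x\<in>U. sym_cond Q' J x = 0)"
  by (simp add: cross_condition_for_Q_def sym_cond_eq[OF assms(1) _ assms(2)] Ay_eq_cov Dyb_eq_mpd
      cov_uminus[OF mat_holomorphic_mpd[OF open_U hol_inv_mult[OF assms(1)]]] neg_eq_iff_add_eq_0)

text \<open>For \<open>Q\<close>, the system turns the condition into a commutator of partial
  derivatives on \<open>inv_mult J Q'\<close>; for \<open>Q'\<close>, in the exchanged order, into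
  one of covariant derivatives on \<open>inv_mult J Q\<close>. The system may be differentiated
  because it holds on an open set.\<close>

lemma BT_system_imp_sym_cond:
  assumes "mat_holomorphic U Q" "mat_holomorphic U Q'" "BT_system U J Q Q'"
    and "x \<in> U" "SDYM3 J x = 0"
  shows "sym_cond Q J x = 0" "sym_cond Q' J x = 0"
proof -
  let ?P = "inv_mult J Q" and ?P' = "inv_mult J Q'"
  note P = hol_inv_mult[OF assms(1)] and P' = hol_inv_mult[OF assms(2)]
  have y: "Ay J ?P u = Dz ?P' u" and z: "Az J ?P u = - Dyb ?P' u" if "u \<in> U" for u
    using assms(3) that by (simp_all add: BT_system_def)
  have "sym_cond Q J x = Dyb (Dz ?P') x + Dz (\<lambda>u. - Dyb ?P' u) x"
    unfolding sym_cond_def Dyb_eq_mpd Dz_eq_mpd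
    by (simp only: mpd_cong[OF open_U assms(4) y] mpd_cong[OF open_U assms(4) z] Dyb_eq_mpd Dz_eq_mpd)
  also have "\<dots> = 0"
    by (simp add: Dyb_eq_mpd Dz_eq_mpd mpd_uminus[OF mat_holomorphic_mpd[OF open_U P'] assms(4)]
        mpd_commute[OF open_U P' assms(4), of "(0,0,1)" "(0,1,0)"])
  finally show "sym_cond Q J x = 0" .
  have yb: "Dyb ?P' u = - Az J ?P u" if "u \<in> U" for u
    using z[OF that] by simp
  have "sym_cond Q' J x = Ay J (\<lambda>u. - Az J ?P u) x + Az J (Ay J ?P) x"
    unfolding sym_cond_eq[OF assms(2,4,5)]
    using cov_cong[OF open_U assms(4) yb] cov_cong[OF open_U assms(4) y]
    by (simp only: Ay_eq_cov Az_eq_cov)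
  also have "\<dots> = 0"
    by (simp add: Ay_eq_cov Az_eq_cov cov_uminus[OF hol_cov[OF P] assms(4)]
        cov_commute[OF P assms(4), of "(1,0,0)" "(0,1,0)"])
  finally show "sym_cond Q' J x = 0" .
qed

lemma SL_function_subset: "open V \<Longrightarrow> V \<subseteq> U \<Longrightarrow> SL_function V J"
  using hol_J det_J mat_holomorphic_subset by unfold_locales blast+

end

section \<open>Local solvability of the system\<close>

lemma matrix_Poincare_neighbourhood:
  assumes "open U" "p \<in> U"
    and "(e, e') = ((1,0,0), (0,1,0)) \<or> (e, e') = ((0,1,0), (0,0,1))"
    and "mat_holomorphic U F" "mat_holomorphic U G"
    and closed: "\<And>x. x \<in> U \<Longrightarrow> mpd e' F x = mpd e G x"
  obtains V R where "open V" "p \<in> V" "V \<subseteq> U" "mat_holomorphic V R"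
    "\<And>x. x \<in> V \<Longrightarrow> mpd e R x = F x" "\<And>x. x \<in> V \<Longrightarrow> mpd e' R x = G x"
proof -
  obtain V where V: "open V" "p \<in> V" "V \<subseteq> U"
    and ex: "\<And>f g. \<lbrakk>holomorphic3 V f; holomorphic3 V g; \<And>x. x \<in> V \<Longrightarrow> pd e' f x = pd e g x\<rbrakk>
       \<Longrightarrow> \<exists>R. holomorphic3 V R \<and> (\<forall>x\<in>V. pd e R x = f x \<and> pd e' R x = g x)"
    using Poincare_neighbourhood[OF assms(1-3)] by metis
  have "\<exists>R. holomorphic3 V R \<and> (\<forall>x\<in>V. pd e R x = F x $ i $ j \<and> pd e' R x = G x $ i $ j)" for i j
  proof (rule ex)
    show "holomorphic3 V (\<lambda>x. F x $ i $ j)" "holomorphic3 V (\<lambda>x. G x $ i $ j)"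
      using mat_holomorphic_subset[OF assms(4) V(3)] mat_holomorphic_subset[OF assms(5) V(3)]
      by (simp_all add: mat_holomorphic_def)
    fix x assume "x \<in> V"
    then have "mpd e' F x $ i $ j = mpd e G x $ i $ j" using closed[of x] V(3) by auto
    then show "pd e' (\<lambda>x. F x $ i $ j) x = pd e (\<lambda>x. G x $ i $ j) x" by (simp add: mpd_def)
  qed
  then obtain R where R: "\<And>i j. holomorphic3 V (R i j)"
      "\<And>i j x. x \<in> V \<Longrightarrow> pd e (R i j) x = F x $ i $ j"
      "\<And>i j x. x \<in> V \<Longrightarrow> pd e' (R i j) x = G x $ i $ j"
    by metis
  show thesis
    using V by (rule that[of V "\<lambda>x. \<chi> i j. R i j x"]) (simp_all add: mat_holomorphic_def mpd_def R vec_eq_iff)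
qed

context SL_function
begin

text \<open>The system prescribes the z- and ybar-derivatives of \<open>inv_mult J Q'\<close>, with
  y as parameter; the cross condition says that this form is closed. The converse localises
  \<open>BT_system_imp_sym_cond\<close> to the neighbourhood of a solution.\<close>

lemma locally_solvable_for_Q'_iff:
  assumes Q: "mat_holomorphic U Q" and sol: "\<And>x. x \<in> U \<Longrightarrow> SDYM3 J x = 0"
  shows "locally_solvable_for_Q' U J Q \<longleftrightarrow> (\<forall>x\<in>U. sym_cond Q J x = 0)"
proof
  assume L: "locally_solvable_for_Q' U J Q"
  show "\<forall>x\<in>U. sym_cond Q J x = 0"
  proof
    fix p assume "p \<in> U"
    with L obtain V Q' where V: "open V" "p \<in> V" "V \<subseteq> U" "mat_holomorphic V Q'" "BT_system V J Q Q'"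
      unfolding locally_solvable_for_Q'_def by meson
    show "sym_cond Q J p = 0"
      by (rule SL_function.BT_system_imp_sym_cond(1)[OF SL_function_subset[OF V(1,3)]
            mat_holomorphic_subset[OF Q V(3)] V(4,5,2) sol[OF \<open>p \<in> U\<close>]])
  qed
next
  assume S: "\<forall>x\<in>U. sym_cond Q J x = 0"
  let ?P = "inv_mult J Q"
  note P = hol_inv_mult[OF Q]
  show "locally_solvable_for_Q' U J Q"
    unfolding locally_solvable_for_Q'_def
  proof
    fix p assume p: "p \<in> U"
    have "mpd (0,0,1) (cov (1,0,0) J ?P) x = mpd (0,1,0) (\<lambda>u. - cov (0,1,0) J ?P u) x" if "x \<in> U" for x
      using S that cross_condition_for_Q'_iff[OF Q]
      by (simp add: cross_condition_for_Q'_def Ay_eq_cov Az_eq_cov Dz_eq_mpd Dyb_eq_mpd)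
    then obtain V R where V: "open V" "p \<in> V" "V \<subseteq> U" and R: "mat_holomorphic V R"
        "\<And>x. x \<in> V \<Longrightarrow> mpd (0,1,0) R x = cov (1,0,0) J ?P x"
        "\<And>x. x \<in> V \<Longrightarrow> mpd (0,0,1) R x = - cov (0,1,0) J ?P x"
      using matrix_Poincare_neighbourhood[OF open_U p, of "(0,1,0)" "(0,0,1)" "cov (1,0,0) J ?P"
          "\<lambda>u. - cov (0,1,0) J ?P u"] hol_cov[OF P] mat_holomorphic_uminus[OF hol_cov[OF P]]
      by blast
    let ?Q' = "\<lambda>x. J x ** R x"
    have eq: "inv_mult J ?Q' x = R x" if "x \<in> V" for x
      using inv_cancel(2)[OF subsetD[OF V(3) that]] by (simp add: inv_mult_def matrix_mul_assoc)
    have "mat_holomorphic V ?Q'"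
      by (rule mat_holomorphic_mult[OF mat_holomorphic_subset[OF hol_J V(3)] R(1)])
    moreover have "BT_system V J Q ?Q'"
      unfolding BT_system_def Ay_eq_cov Az_eq_cov Dz_eq_mpd Dyb_eq_mpd
      by (simp add: mpd_cong[OF V(1) _ eq] R(2,3))
    ultimately show "\<exists>V Q'. open V \<and> p \<in> V \<and> V \<subseteq> U \<and> mat_holomorphic V Q' \<and> BT_system V J Q Q'"
      using V by blast
  qed
qed

text \<open>What is prescribed are covariant derivatives of \<open>inv_mult J Q\<close>. Conjugation
  by \<open>J\<close> makes them ordinary y- and z-derivatives of a new unknown, with ybar as
  parameter.\<close>

lemma locally_solvable_for_Q_iff:
  assumes Q': "mat_holomorphic U Q'" and sol: "\<And>x. x \<in> U \<Longrightarrow> SDYM3 J x = 0"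
  shows "locally_solvable_for_Q U J Q' \<longleftrightarrow> (\<forall>x\<in>U. sym_cond Q' J x = 0)"
proof
  assume L: "locally_solvable_for_Q U J Q'"
  show "\<forall>x\<in>U. sym_cond Q' J x = 0"
  proof
    fix p assume "p \<in> U"
    with L obtain V Q where V: "open V" "p \<in> V" "V \<subseteq> U" "mat_holomorphic V Q" "BT_system V J Q Q'"
      unfolding locally_solvable_for_Q_def by meson
    show "sym_cond Q' J p = 0"
      by (rule SL_function.BT_system_imp_sym_cond(2)[OF SL_function_subset[OF V(1,3)]
            V(4) mat_holomorphic_subset[OF Q' V(3)] V(5,2) sol[OF \<open>p \<in> U\<close>]])
  qed
next
  assume S: "\<forall>x\<in>U. sym_cond Q' J x = 0"
  let ?P' = "inv_mult J Q'"
  let ?f = "mpd (0,1,0) ?P'" and ?g = "\<lambda>u. - mpd (0,0,1) ?P' u"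
  have f: "mat_holomorphic U ?f" and g: "mat_holomorphic U ?g"
    by (intro mat_holomorphic_uminus mat_holomorphic_mpd[OF open_U hol_inv_mult[OF Q']])+
  let ?F = "\<lambda>u. J u ** ?f u ** Ji u" and ?G = "\<lambda>u. J u ** ?g u ** Ji u"
  have F: "mat_holomorphic U ?F" and G: "mat_holomorphic U ?G"
    by (rule mat_holomorphic_mult[OF mat_holomorphic_mult[OF hol_J f] hol_Ji]
        mat_holomorphic_mult[OF mat_holomorphic_mult[OF hol_J g] hol_Ji])+
  show "locally_solvable_for_Q U J Q'"
    unfolding locally_solvable_for_Q_def
  proof
    fix p assume p: "p \<in> U"
    \<comment> \<open>By \<open>conj_cov\<close> the two sides are the conjugates by
      \<open>J\<close> of the two sides of the cross condition.\<close>
    have "mpd (0,1,0) ?F x = mpd (1,0,0) ?G x" if "x \<in> U" for x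
    proof -
      have "cov (1,0,0) J ?g x = cov (0,1,0) J ?f x"
        using S that cross_condition_for_Q_iff[OF Q' sol]
        by (simp add: cross_condition_for_Q_def Ay_eq_cov Az_eq_cov Dz_eq_mpd Dyb_eq_mpd)
      then show ?thesis
        by (simp only: conj_cov[OF f that, symmetric] conj_cov[OF g that, symmetric])
    qed
    then obtain V R where V: "open V" "p \<in> V" "V \<subseteq> U" and R: "mat_holomorphic V R"
        "\<And>x. x \<in> V \<Longrightarrow> mpd (1,0,0) R x = ?F x" "\<And>x. x \<in> V \<Longrightarrow> mpd (0,1,0) R x = ?G x"
      using matrix_Poincare_neighbourhood[OF open_U p, of "(1,0,0)" "(0,1,0)" ?F ?G] F G
      by blast
    interpret V: SL_function V J by (rule SL_function_subset[OF V(1,3)])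
    \<comment> \<open>The unknown is \<open>R\<close> = J (J^-1 Q) J^-1 = Q J^-1, which determines
      \<open>?Q\<close>; \<open>?P\<close> is the corresponding J^-1 Q.\<close>
    let ?P = "\<lambda>x. Ji x ** R x ** J x" and ?Q = "\<lambda>x. R x ** J x"
    have P: "mat_holomorphic V ?P" and Q: "mat_holomorphic V ?Q"
      by (rule mat_holomorphic_mult[OF mat_holomorphic_mult[OF V.hol_Ji R(1)] V.hol_J]
          mat_holomorphic_mult[OF R(1) V.hol_J])+
    have R_eq: "J x ** ?P x ** Ji x = R x" if "x \<in> V" for x
      by (simp add: V.inv_cancel[OF that] matrix_mul_assoc)
    have cov_P: "cov e J (inv_mult J ?Q) x = Ji x ** mpd e R x ** J x" if "x \<in> V" for e x
      unfolding inv_mult_def matrix_mul_assoc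
      by (simp only: V.cov_eq_conj[OF P that] mpd_cong[OF V(1) that R_eq])
    have "BT_system V J ?Q Q'"
      unfolding BT_system_def Ay_eq_cov Az_eq_cov Dz_eq_mpd Dyb_eq_mpd
      by (simp add: cov_P R V.inv_cancel matrix_mul_assoc)
    with V Q show "\<exists>V Q. open V \<and> p \<in> V \<and> V \<subseteq> U \<and> mat_holomorphic V Q \<and> BT_system V J Q Q'"
      by blast
  qed
qed

end

text \<open>An integrability condition can be read as the formal cross-derivative equation or as
  actual local solvability. Both readings are covered: the first is algebra with commutators, the
  second adds the integration of closed forms.\<close>

theorem mainTheorem2:
  fixes U :: "(complex \<times> complex \<times> complex) set"
    and J :: "complex \<times> complex \<times> complex \<Rightarrow> complex^'n::finite^'n"
  assumes "open U"
    and "SL_valued_solution U J"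
  shows
    "(\<forall>M. mat_holomorphic U M \<longrightarrow>
        (\<forall>x\<in>U. op_comm Dyb Dz M x = 0 \<and> op_comm (Ay J) (Az J) M x = 0)) \<and>
     (\<forall>Q. mat_holomorphic U Q \<longrightarrow>
        (cross_condition_for_Q' U J Q \<longleftrightarrow> (\<forall>x\<in>U. sym_cond Q J x = 0)) \<and>
        (locally_solvable_for_Q' U J Q \<longleftrightarrow> (\<forall>x\<in>U. sym_cond Q J x = 0))) \<and>
     (\<forall>Q'. mat_holomorphic U Q' \<longrightarrow>
        (cross_condition_for_Q U J Q' \<longleftrightarrow> (\<forall>x\<in>U. sym_cond Q' J x = 0)) \<and>
        (locally_solvable_for_Q U J Q' \<longleftrightarrow> (\<forall>x\<in>U. sym_cond Q' J x = 0))) \<and>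
     (\<forall>Q Q'. mat_holomorphic U Q \<and> mat_holomorphic U Q' \<and> BT_system U J Q Q' \<longrightarrow>
        symmetry_characteristic U J Q \<and> symmetry_characteristic U J Q')"
proof -
  have sol: "SDYM3 J x = 0" if "x \<in> U" for x
    using assms(2) that by (simp add: SL_valued_solution_def)
  interpret SL_function U J
    using assms by unfold_locales (simp_all add: SL_valued_solution_def)
  have "op_comm Dyb Dz M x = 0 \<and> op_comm (Ay J) (Az J) M x = 0"
    if "mat_holomorphic U M" "x \<in> U" for M x
    by (simp add: op_comm_def Ay_eq_cov Az_eq_cov Dyb_eq_mpd Dz_eq_mpd
        mpd_commute[OF open_U that, of "(0,0,1)" "(0,1,0)"]
        cov_commute[OF that, of "(1,0,0)" "(0,1,0)"])
  moreover have "symmetry_characteristic U J Q \<and> symmetry_characteristic U J Q'"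
    if "mat_holomorphic U Q" "mat_holomorphic U Q'" "BT_system U J Q Q'" for Q Q'
    using that BT_system_imp_sym_cond[OF that _ sol] by (simp add: symmetry_characteristic_def)
  ultimately show ?thesis
    using cross_condition_for_Q'_iff cross_condition_for_Q_iff[OF _ sol]
      locally_solvable_for_Q'_iff[OF _ sol] locally_solvable_for_Q_iff[OF _ sol]
    by blast
qed

end
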